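(* Let $\mathcal{H}\in C^1(\mathbb{S}^2)$ be such that $\mathcal{H}(x)=h_0(x)+\lambda$ for all $x\in\mathbb{S}^2$, where $\lambda\in\mathbb{R}$ and $h_0\in C^1(\mathbb{S}^2)$ is not identically zero. If there is $v\in\mathbb{S}^2$ such that $h_0(x)\langle x,v\rangle\geq 0$ for all $x\in\mathbb{S}^2$, then there are no closed $\mathcal{H}$-surfaces in $\mathbb{R}^3$.
   Context: $\mathbb{S}^2$ is the unit sphere of $\mathbb{R}^3$ and $\langle\cdot,\cdot\rangle$ the Euclidean metric. Surfaces are smooth, connected and oriented, immersed in $\mathbb{R}^3$, with Gauss map (unit normal field) $N:M\to\mathbb{S}^2$. The mean curvature $H_M$ is the average of the principal curvatures with respect to $N$, with the sign convention that the graph of $u$ oriented by $N=(-Du,1)/\sqrt{1+|Du|^2}$ has $2H_M=\mathrm{div}\big(Du/\sqrt{1+|Du|^2}\big)$ (so a unit sphere with inward normal has $H_M=1$). Given $\mathcal{H}\in C^1(\mathbb{S}^2)$, an $\mathcal{H}$-surface is a surface $M$ such that $H_M(p)=\mathcal{H}(N_p)$ for all $p\in M$. A surface is closed if it is compact without boundary. *)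

theory Defs
  imports "HOL-Analysis.Analysis"
begin

section \<open>Functions of class C^k\<close>

(* Meant for open S, where (at x) sees only values of f inside S. *)
fun Ck_on :: "nat \<Rightarrow> ('a::euclidean_space \<Rightarrow> 'b::real_normed_vector) \<Rightarrow> 'a set \<Rightarrow> bool" where
  "Ck_on 0 f S \<longleftrightarrow> continuous_on S f"
| "Ck_on (Suc k) f S \<longleftrightarrow>
     (\<forall>x\<in>S. f differentiable (at x)) \<and>
     (\<forall>v. Ck_on k (\<lambda>x. frechet_derivative f (at x) v) S)"

definition smooth_on :: "('a::euclidean_space \<Rightarrow> 'b::real_normed_vector) \<Rightarrow> 'a set \<Rightarrow> bool" where
  "smooth_on f S \<longleftrightarrow> (\<forall>k. Ck_on k f S)"

(* C^1 on the embedded submanifold S^2: restriction of a C^1 function on a neighbourhood.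
   Values of f off the sphere are irrelevant. *)
definition C1_on_sphere :: "(real^3 \<Rightarrow> real) \<Rightarrow> bool" where
  "C1_on_sphere f \<longleftrightarrow>
     (\<exists>U g. open U \<and> sphere 0 1 \<subseteq> U \<and> Ck_on 1 g U \<and> (\<forall>x\<in>sphere 0 1. g x = f x))"

section \<open>Smooth surfaces\<close>

type_synonym 'a chart = "'a set \<times> ('a \<Rightarrow> real^2)"

abbreviation chart_dom :: "'a chart \<Rightarrow> 'a set" where "chart_dom c \<equiv> fst c"

abbreviation chart_map :: "'a chart \<Rightarrow> 'a \<Rightarrow> real^2" where "chart_map c \<equiv> snd c"

definition in_chart :: "'a chart \<Rightarrow> ('a \<Rightarrow> 'b) \<Rightarrow> real^2 \<Rightarrow> 'b" where
  "in_chart c f = f \<circ> inv_into (chart_dom c) (chart_map c)"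

(* The differential of f at p, precomposed with the identification of R^2 with T_p M
   given by the chart c. *)
definition chart_deriv ::
    "'a chart \<Rightarrow> ('a \<Rightarrow> 'b::real_normed_vector) \<Rightarrow> 'a \<Rightarrow> real^2 \<Rightarrow> 'b" where
  "chart_deriv c f p = frechet_derivative (in_chart c f) (at (chart_map c p))"

definition is_chart :: "'a topology \<Rightarrow> 'a chart \<Rightarrow> bool" where
  "is_chart M c \<longleftrightarrow>
     openin M (chart_dom c) \<and> open (chart_map c ` chart_dom c) \<and>
     homeomorphic_map (subtopology M (chart_dom c))
       (top_of_set (chart_map c ` chart_dom c)) (chart_map c)"

definition smooth_atlas :: "'a topology \<Rightarrow> 'a chart set \<Rightarrow> bool" where
  "smooth_atlas M A \<longleftrightarrow>
     (\<forall>c\<in>A. is_chart M c) \<and> (\<Union>c\<in>A. chart_dom c) = topspace M \<and>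
     (\<forall>c\<in>A. \<forall>d\<in>A.
        smooth_on (in_chart c (chart_map d)) (chart_map c ` (chart_dom c \<inter> chart_dom d)))"

(* Charts take values in open subsets of R^2, so surfaces have no boundary.
   connected_space admits the empty space, hence the nonemptiness condition. *)
definition smooth_connected_surface :: "'a topology \<Rightarrow> 'a chart set \<Rightarrow> bool" where
  "smooth_connected_surface M A \<longleftrightarrow>
     Hausdorff_space M \<and> second_countable M \<and>
     connected_space M \<and> topspace M \<noteq> {} \<and> smooth_atlas M A"

definition smooth_map :: "'a chart set \<Rightarrow> ('a \<Rightarrow> 'b::real_normed_vector) \<Rightarrow> bool" where
  "smooth_map A f \<longleftrightarrow> (\<forall>c\<in>A. smooth_on (in_chart c f) (chart_map c ` chart_dom c))"

section \<open>Immersed oriented surfaces in R^3 and their curvature\<close>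

definition immersion :: "'a chart set \<Rightarrow> ('a \<Rightarrow> real^3) \<Rightarrow> bool" where
  "immersion A \<psi> \<longleftrightarrow>
     smooth_map A \<psi> \<and> (\<forall>c\<in>A. \<forall>p\<in>chart_dom c. inj (chart_deriv c \<psi> p))"

(* The image of T_p M under the differential of \<psi>, a plane in R^3. *)
definition tangent_plane :: "'a chart set \<Rightarrow> ('a \<Rightarrow> real^3) \<Rightarrow> 'a \<Rightarrow> (real^3) set" where
  "tangent_plane A \<psi> p = {chart_deriv c \<psi> p u | c u. c \<in> A \<and> p \<in> chart_dom c}"

definition gauss_map ::
    "'a topology \<Rightarrow> 'a chart set \<Rightarrow> ('a \<Rightarrow> real^3) \<Rightarrow> ('a \<Rightarrow> real^3) \<Rightarrow> bool" where
  "gauss_map M A \<psi> N \<longleftrightarrow>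
     smooth_map A N \<and>
     (\<forall>p\<in>topspace M. N p \<in> sphere 0 1 \<and> (\<forall>w\<in>tangent_plane A \<psi> p. N p \<bullet> w = 0))"

(* An orientation of an immersed surface is encoded by the choice of unit normal N. *)
definition oriented_immersed_surface ::
    "'a topology \<Rightarrow> 'a chart set \<Rightarrow> ('a \<Rightarrow> real^3) \<Rightarrow> ('a \<Rightarrow> real^3) \<Rightarrow> bool" where
  "oriented_immersed_surface M A \<psi> N \<longleftrightarrow>
     smooth_connected_surface M A \<and> immersion A \<psi> \<and> gauss_map M A \<psi> N"

(* The endomorphism  - dN o (d\<psi>)^(-1)  of the tangent plane; meaningful only there.
   With this sign the unit sphere with inward normal has both principal curvatures 1. *)
definition shape_operator ::
    "'a chart set \<Rightarrow> ('a \<Rightarrow> real^3) \<Rightarrow> ('a \<Rightarrow> real^3) \<Rightarrow> 'a \<Rightarrow> real^3 \<Rightarrow> real^3" where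
  "shape_operator A \<psi> N p w =
     (THE z. \<exists>c\<in>A. \<exists>u. p \<in> chart_dom c \<and>
        w = chart_deriv c \<psi> p u \<and> z = - chart_deriv c N p u)"

(* k1, k2 are the eigenvalues of the shape operator, counted with multiplicity. *)
definition principal_curvatures ::
    "'a chart set \<Rightarrow> ('a \<Rightarrow> real^3) \<Rightarrow> ('a \<Rightarrow> real^3) \<Rightarrow> 'a \<Rightarrow> real \<Rightarrow> real \<Rightarrow> bool" where
  "principal_curvatures A \<psi> N p k1 k2 \<longleftrightarrow>
     (\<exists>e1\<in>tangent_plane A \<psi> p. \<exists>e2\<in>tangent_plane A \<psi> p.
        norm e1 = 1 \<and> norm e2 = 1 \<and> e1 \<bullet> e2 = 0 \<and>
        shape_operator A \<psi> N p e1 = k1 *\<^sub>R e1 \<and>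
        shape_operator A \<psi> N p e2 = k2 *\<^sub>R e2)"

definition mean_curvature ::
    "'a chart set \<Rightarrow> ('a \<Rightarrow> real^3) \<Rightarrow> ('a \<Rightarrow> real^3) \<Rightarrow> 'a \<Rightarrow> real" where
  "mean_curvature A \<psi> N p =
     (THE h. \<exists>k1 k2. principal_curvatures A \<psi> N p k1 k2 \<and> h = (k1 + k2) / 2)"

definition H_surface ::
    "(real^3 \<Rightarrow> real) \<Rightarrow> 'a topology \<Rightarrow> 'a chart set \<Rightarrow> ('a \<Rightarrow> real^3) \<Rightarrow> ('a \<Rightarrow> real^3) \<Rightarrow> bool"
  where
  "H_surface \<H> M A \<psi> N \<longleftrightarrow>
     oriented_immersed_surface M A \<psi> N \<and>
     (\<forall>p\<in>topspace M. mean_curvature A \<psi> N p = \<H> (N p))"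

definition closed_H_surface ::
    "(real^3 \<Rightarrow> real) \<Rightarrow> 'a topology \<Rightarrow> 'a chart set \<Rightarrow> ('a \<Rightarrow> real^3) \<Rightarrow> ('a \<Rightarrow> real^3) \<Rightarrow> bool"
  where
  "closed_H_surface \<H> M A \<psi> N \<longleftrightarrow> H_surface \<H> M A \<psi> N \<and> compact_space M"

end

theory Submission
  imports Defs
begin

text \<open>
  The idea is to combine a flux formula with a maximum principle.  Let \<open>\<psi>\<close> be a closed surface with
  normal N and \<open>H = h\<^sub>0(N) + \<lambda>\<close>, and let v be the given direction.  The derivative of the \<open>\<real>\<^sup>3\<close>-valued
  1-form \<open>N \<times> d\<psi>\<close> is \<open>-2 H N dA\<close>, because N has derivative minus the shape operator, and the
  derivative of \<open>\<psi> \<times> d\<psi>\<close> is \<open>2 N dA\<close>.  Hence \<open>2 (H - \<lambda>) \<langle>N, v\<rangle> dA\<close> is exact; its primitive has the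
  form \<open>\<langle>B, d\<psi>\<rangle>\<close> with B built from N, \<open>\<psi>\<close> and v (\<open>wedge_form_flux_potential\<close>).  As M is closed, the
  integral of this form is zero.  Its integrand is \<open>2 h\<^sub>0(N) \<langle>N, v\<rangle> \<ge> 0\<close> by hypothesis, so it vanishes
  at every point (\<open>flux_integrand_eq_0_if_nonneg\<close>).  Therefore \<open>h\<^sub>0(N) = 0\<close> wherever \<open>\<langle>N, v\<rangle> \<noteq> 0\<close>, and
  also where \<open>\<langle>N, v\<rangle> = 0\<close>, since \<open>h\<^sub>0\<close> is nonnegative on one side of the equator, nonpositive on the other,
  and so zero on it
  (\<open>eq_0_on_equator\<close>).

  Thus H is the constant \<open>\<lambda>\<close>.  Comparison with a large sphere at a point farthest from the origin shows
  \<open>\<lambda> \<noteq> 0\<close>.  At a highest point in a direction w the normal is \<open>\<plusminus> w\<close>, and comparison with the tangent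
  plane leaves only \<open>N = - sgn(\<lambda>) w\<close>.  So the Gauss map is onto the sphere
  (\<open>normal_surj_if_constant_mean_curvature\<close>) and \<open>h\<^sub>0\<close> is identically zero, a contradiction.

  Stokes' theorem on the surface (\<open>wedge_density_eq_0_if_nonneg\<close>) is proved from a partition of unity,
  the change of variables formula, and its version for a compactly supported form in a coordinate domain
  (\<open>integral_wedge_compact_support_eq_0\<close>).  The latter amounts to the translation invariance of Lebesgue
  measure together with the symmetry of second derivatives.  That the mean curvature is half the trace of
  the shape operator at every point rests on the spectral theorem in the tangent plane
  (\<open>exists_principal_directions\<close>), which again uses the symmetry of second derivatives.
\<close>

section \<open>Calculus of functions of class C^1\<close>

lemma C1_onI:
  assumes "open S"
    and der: "\<And>x. x \<in> S \<Longrightarrow> (f has_derivative f' x) (at x)"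
    and cont: "\<And>v. continuous_on S (\<lambda>x. f' x v)"
  shows "Ck_on 1 f S"
proof -
  have "frechet_derivative f (at x) = f' x" if "x \<in> S" for x
    using der[OF that] by (metis frechet_derivative_at)
  then have "continuous_on S (\<lambda>x. frechet_derivative f (at x) v)" for v
    using cont[of v] by (simp cong: continuous_on_cong)
  then show ?thesis
    using der by (auto simp: differentiable_def)
qed

lemma C1_on_has_derivative:
  assumes "Ck_on 1 f S" "x \<in> S"
  shows "(f has_derivative frechet_derivative f (at x)) (at x)"
  using assms by (auto simp: frechet_derivative_works)

lemma C1_on_continuous_derivative:
  assumes "Ck_on 1 f S"
  shows "continuous_on S (\<lambda>x. frechet_derivative f (at x) v)"
  using assms by auto

lemma C1_on_imp_continuous_on:
  assumes "Ck_on 1 f S"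
  shows "continuous_on S f"
  using assms by (auto intro!: continuous_at_imp_continuous_on differentiable_imp_continuous_within)

lemma Ck_on_Suc_imp_C1_on:
  assumes "Ck_on (Suc (Suc 0)) f S"
  shows "Ck_on 1 f S"
proof -
  have "continuous_on S (\<lambda>x. frechet_derivative f (at x) v)" for v
    using assms C1_on_imp_continuous_on[of "\<lambda>x. frechet_derivative f (at x) v" S] by auto
  then show ?thesis using assms by auto
qed

lemma C1_on_cong:
  assumes "open S" "Ck_on 1 g S" "\<And>x. x \<in> S \<Longrightarrow> f x = g x"
  shows "Ck_on 1 f S"
  using assms(1)
proof (rule C1_onI)
  show "(f has_derivative frechet_derivative g (at x)) (at x)" if "x \<in> S" for x
    using C1_on_has_derivative[OF assms(2) that] assms(1) that
    by (rule has_derivative_transform_within_open) (simp add: assms(3))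
qed (rule C1_on_continuous_derivative[OF assms(2)])

lemma C1_on_Un:
  assumes "open S" "open T" "Ck_on 1 f S" "Ck_on 1 f T"
  shows "Ck_on 1 f (S \<union> T)"
  using assms by (auto intro!: continuous_on_open_Un)

lemma C1_on_const: "open S \<Longrightarrow> Ck_on 1 (\<lambda>x. c) S"
  by (rule C1_onI[where f' = "\<lambda>x h. 0"]) auto

lemma C1_on_bounded_bilinear:
  assumes "bounded_bilinear pr" "open S" "Ck_on 1 f S" "Ck_on 1 g S"
  shows "Ck_on 1 (\<lambda>x. pr (f x) (g x)) S"
proof (rule C1_onI[OF \<open>open S\<close>])
  note cont = bounded_bilinear.continuous_on[OF assms(1)]
  show "((\<lambda>x. pr (f x) (g x)) has_derivative
      (\<lambda>h. pr (f x) (frechet_derivative g (at x) h) + pr (frechet_derivative f (at x) h) (g x))) (at x)"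
    if "x \<in> S" for x
    using bounded_bilinear.FDERIV[OF assms(1) C1_on_has_derivative[OF assms(3) that]
        C1_on_has_derivative[OF assms(4) that]] .
  show "continuous_on S (\<lambda>x. pr (f x) (frechet_derivative g (at x) v) +
      pr (frechet_derivative f (at x) v) (g x))" for v
    by (intro continuous_on_add cont C1_on_imp_continuous_on C1_on_continuous_derivative assms)
qed

lemma C1_on_bounded_linear:
  assumes "bounded_linear L" "open S" "Ck_on 1 f S"
  shows "Ck_on 1 (\<lambda>x. L (f x)) S"
proof (rule C1_onI[OF \<open>open S\<close>])
  show "((\<lambda>x. L (f x)) has_derivative (\<lambda>h. L (frechet_derivative f (at x) h))) (at x)"
    if "x \<in> S" for x
    using bounded_linear.has_derivative[OF assms(1) C1_on_has_derivative[OF assms(3) that]] .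
  show "continuous_on S (\<lambda>x. L (frechet_derivative f (at x) v))" for v
    by (intro bounded_linear.continuous_on[OF assms(1)] C1_on_continuous_derivative assms)
qed

lemma C1_on_add:
  assumes "open S" "Ck_on 1 f S" "Ck_on 1 g S"
  shows "Ck_on 1 (\<lambda>x. f x + g x) S"
proof (rule C1_onI[OF \<open>open S\<close>])
  show "((\<lambda>x. f x + g x) has_derivative
      (\<lambda>h. frechet_derivative f (at x) h + frechet_derivative g (at x) h)) (at x)" if "x \<in> S" for x
    by (intro has_derivative_add C1_on_has_derivative[of _ S] assms that)
  show "continuous_on S (\<lambda>x. frechet_derivative f (at x) v + frechet_derivative g (at x) v)" for v
    by (intro continuous_on_add C1_on_continuous_derivative assms)
qed

lemma C1_on_sum:
  assumes "open S" "finite I" "\<And>i. i \<in> I \<Longrightarrow> Ck_on 1 (f i) S"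
  shows "Ck_on 1 (\<lambda>x. \<Sum>i\<in>I. f i x) S"
  using assms(2,3)
  by (induction I) (auto simp del: Ck_on.simps One_nat_def intro!: C1_on_const C1_on_add assms(1))

lemma C1_on_inverse:
  fixes f :: "'a::euclidean_space \<Rightarrow> real"
  assumes "open S" "Ck_on 1 f S" "\<And>x. x \<in> S \<Longrightarrow> f x \<noteq> 0"
  shows "Ck_on 1 (\<lambda>x. inverse (f x)) S"
proof (rule C1_onI[OF \<open>open S\<close>])
  show "((\<lambda>x. inverse (f x)) has_derivative
      (\<lambda>h. - (inverse (f x) * frechet_derivative f (at x) h * inverse (f x)))) (at x)" if "x \<in> S" for x
    by (rule Deriv.has_derivative_inverse[OF assms(3)[OF that] C1_on_has_derivative[OF assms(2) that]])
  show "continuous_on S (\<lambda>x. - (inverse (f x) * frechet_derivative f (at x) v * inverse (f x)))" for v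
    by (intro continuous_intros C1_on_continuous_derivative C1_on_imp_continuous_on assms)
      (use assms(3) in auto)
qed

lemma C1_on_compose:
  fixes g :: "'a::euclidean_space \<Rightarrow> 'b::euclidean_space"
  assumes "open S" "Ck_on 1 g S" "Ck_on 1 f T" "g ` S \<subseteq> T"
  shows "Ck_on 1 (\<lambda>x. f (g x)) S"
proof (rule C1_onI[OF \<open>open S\<close>])
  have lin: "linear (frechet_derivative f (at (g x)))" if "x \<in> S" for x
    using C1_on_has_derivative[OF assms(3)] that assms(4)
    by (meson has_derivative_linear image_subset_iff)
  show "((\<lambda>x. f (g x)) has_derivative
      (\<lambda>h. frechet_derivative f (at (g x)) (frechet_derivative g (at x) h))) (at x)" if "x \<in> S" for x
    using diff_chain_at[OF C1_on_has_derivative[OF assms(2) that] C1_on_has_derivative[OF assms(3)]]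
      that assms(4) by (auto simp: o_def)
  \<comment> \<open>Only the directional derivatives of f are known to be continuous, so the direction
      is expanded in a basis.\<close>
  show "continuous_on S (\<lambda>x. frechet_derivative f (at (g x)) (frechet_derivative g (at x) v))" for v
  proof (rule continuous_on_eq)
    show "continuous_on S (\<lambda>x. \<Sum>b\<in>Basis. (frechet_derivative g (at x) v \<bullet> b) *\<^sub>R
        frechet_derivative f (at (g x)) b)"
    proof (intro continuous_intros C1_on_continuous_derivative[OF assms(2)])
      show "continuous_on S (\<lambda>x. frechet_derivative f (at (g x)) b)" for b
        using continuous_on_compose2[OF C1_on_continuous_derivative[OF assms(3), of b]
            C1_on_imp_continuous_on[OF assms(2)] assms(4)] .
    qed
    show "(\<Sum>b\<in>Basis. (frechet_derivative g (at x) v \<bullet> b) *\<^sub>R frechet_derivative f (at (g x)) b) =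
        frechet_derivative f (at (g x)) (frechet_derivative g (at x) v)" if "x \<in> S" for x
    proof -
      have "frechet_derivative f (at (g x)) (\<Sum>b\<in>Basis. (frechet_derivative g (at x) v \<bullet> b) *\<^sub>R b) =
          (\<Sum>b\<in>Basis. (frechet_derivative g (at x) v \<bullet> b) *\<^sub>R frechet_derivative f (at (g x)) b)"
        using lin[OF that] by (simp add: linear_sum linear_cmul)
      then show ?thesis by (simp add: euclidean_representation)
    qed
  qed
qed

lemma has_derivative_positive_part_squared:
  "((\<lambda>s::real. (max 0 s)\<^sup>2) has_real_derivative 2 * max 0 s) (at s)"
proof -
  consider "s < 0" | "s > 0" | "s = 0" by linarith
  then show ?thesis
  proof cases
    case 1
    then have "((\<lambda>s::real. 0) has_real_derivative 2 * max 0 s) (at s)" by auto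
    then show ?thesis
      by (rule has_field_derivative_transform_within_open[where S = "{..<0}"]) (use 1 in auto)
  next
    case 2
    then have "((\<lambda>s::real. s\<^sup>2) has_real_derivative 2 * max 0 s) (at s)"
      by (auto intro!: derivative_eq_intros)
    then show ?thesis
      by (rule has_field_derivative_transform_within_open[where S = "{0<..}"]) (use 2 in auto)
  next
    case 3
    have "((\<lambda>h::real. (max 0 h)\<^sup>2 / h) \<longlongrightarrow> 0) (at 0)"
    proof (rule Lim_null_comparison[where g = "\<lambda>h. \<bar>h\<bar>"])
      show "\<forall>\<^sub>F h::real in at 0. norm ((max 0 h)\<^sup>2 / h) \<le> \<bar>h\<bar>"
        by (rule always_eventually) (auto simp: max_def power2_eq_square)
      show "((\<lambda>h::real. \<bar>h\<bar>) \<longlongrightarrow> 0) (at 0)"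
        by (auto intro!: tendsto_eq_intros)
    qed
    with 3 show ?thesis by (simp add: DERIV_def)
  qed
qed

text \<open>The square of the positive part is of class C^1, which is all that is asked of a partition of unity
  below.\<close>

definition bump :: "'a::euclidean_space \<Rightarrow> real \<Rightarrow> 'a \<Rightarrow> real" where
  "bump a r x = (max 0 (r\<^sup>2 - (x - a) \<bullet> (x - a)))\<^sup>2"

lemma C1_on_bump: "Ck_on 1 (bump a r) UNIV"
proof (rule C1_onI[OF open_UNIV])
  let ?s = "\<lambda>x. r\<^sup>2 - (x - a) \<bullet> (x - a)"
  show "(bump a r has_derivative (\<lambda>h. 2 * max 0 (?s x) * (- 2 * ((x - a) \<bullet> h)))) (at x)" for x
  proof -
    have "(?s has_derivative (\<lambda>h. - 2 * ((x - a) \<bullet> h))) (at x)"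
      by (auto intro!: derivative_eq_intros simp: inner_commute algebra_simps)
    moreover have "((\<lambda>s. (max 0 s)\<^sup>2) has_derivative (\<lambda>h. 2 * max 0 (?s x) * h)) (at (?s x))"
      using has_derivative_positive_part_squared[of "?s x"] by (simp add: has_field_derivative_def)
    ultimately show ?thesis
      using diff_chain_at[of ?s] by (fastforce simp: bump_def[abs_def] o_def)
  qed
  show "continuous_on UNIV (\<lambda>x. 2 * max 0 (?s x) * (- 2 * ((x - a) \<bullet> v)))" for v
    by (intro continuous_intros)
qed

lemma bump_nonneg: "bump a r x \<ge> 0"
  by (simp add: bump_def)

lemma bump_pos_iff:
  assumes "r > 0"
  shows "bump a r x > 0 \<longleftrightarrow> x \<in> ball a r"
proof -
  have "bump a r x > 0 \<longleftrightarrow> (norm (x - a))\<^sup>2 < r\<^sup>2"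
    by (auto simp: bump_def dot_square_norm max_def power2_eq_square zero_less_mult_iff split: if_splits)
  also have "\<dots> \<longleftrightarrow> x \<in> ball a r"
    using assms power2_less_imp_less[of "norm (x - a)" r] power_strict_mono[of "norm (x - a)" r 2]
    by (auto simp: dist_norm norm_minus_commute)
  finally show ?thesis .
qed

text \<open>Translation leaves the integral of f over a large box unchanged; differentiating under the
  integral sign in the direction of the translation gives the claim.\<close>

lemma integral_directional_derivative_eq_0:
  fixes f :: "'a::euclidean_space \<Rightarrow> real"
  assumes der: "\<And>x. (f has_derivative f' x) (at x)"
    and cont: "continuous_on UNIV (\<lambda>x. f' x e)"
    and bd: "bounded K" and zero: "\<And>x. x \<notin> K \<Longrightarrow> f x = 0"
  shows "integral UNIV (\<lambda>x. f' x e) = 0"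
proof -
  let ?K = "(\<lambda>x. fst x - snd x *\<^sub>R e) ` (K \<times> {-1..1})"
  have "bounded ?K"
  proof -
    obtain B where B: "\<And>x. x \<in> K \<Longrightarrow> norm x \<le> B" using bd bounded_iff by blast
    have "norm (x - t *\<^sub>R e) \<le> B + norm e" if "x \<in> K" "t \<in> {-1..1}" for x t
    proof -
      have "norm (x - t *\<^sub>R e) \<le> norm x + \<bar>t\<bar> * norm e"
        using norm_triangle_ineq4[of x "t *\<^sub>R e"] by simp
      also have "\<dots> \<le> B + 1 * norm e"
        using that B by (intro add_mono mult_right_mono) auto
      finally show ?thesis by simp
    qed
    then show ?thesis unfolding bounded_iff by fastforce
  qed
  then obtain c where c: "?K \<subseteq> cbox (-c) c"
    using bounded_subset_cbox_symmetric by blast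
  have shift0: "f (x + t *\<^sub>R e) = 0" if "t \<in> {-1..1}" "x \<notin> cbox (-c) c" for x t
  proof (rule zero, rule notI)
    assume "x + t *\<^sub>R e \<in> K"
    then have "x \<in> ?K" using that(1) by (intro image_eqI[where x = "(x + t *\<^sub>R e, t)"]) auto
    with c that(2) show False by blast
  qed
  have contf: "continuous_on UNIV f"
    using der by (meson has_derivative_continuous_on has_derivative_at_withinI)
  have const: "integral (cbox (-c) c) (\<lambda>x. f (x + t *\<^sub>R e)) = integral UNIV f" if t: "t \<in> {-1..1}" for t
  proof -
    have "(f has_integral integral (cbox (-c) c) f) (cbox (-c) c)"
      using integrable_continuous[OF continuous_on_subset[OF contf]] by (auto simp: integrable_integral)
    then have *: "(f has_integral integral (cbox (-c) c) f) (cbox (-c) c)"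
        "(f has_integral integral (cbox (-c) c) f) UNIV"
      by (auto elim!: has_integral_on_superset simp: shift0[of 0, simplified])
    have "continuous_on (cbox (-c) c) (\<lambda>x. f (x + t *\<^sub>R e))"
      by (intro continuous_on_compose2[OF contf] continuous_intros) auto
    then have "((\<lambda>x. f (x + t *\<^sub>R e)) has_integral integral (cbox (-c) c) (\<lambda>x. f (x + t *\<^sub>R e))) (cbox (-c) c)"
      by (intro integrable_integral integrable_continuous)
    then have "((\<lambda>x. f (x + t *\<^sub>R e)) has_integral integral (cbox (-c) c) (\<lambda>x. f (x + t *\<^sub>R e))) UNIV"
      by (rule has_integral_on_superset) (use shift0[OF t] in auto)
    moreover have "((\<lambda>x. f (x + t *\<^sub>R e)) has_integral integral (cbox (-c) c) f) UNIV"
    proof (rule has_integral_on_superset)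
      show "((\<lambda>x. f (x + t *\<^sub>R e)) has_integral integral (cbox (-c) c) f)
          (cbox (-c - t *\<^sub>R e) (c - t *\<^sub>R e))"
        using has_integral_affinity'[OF *(1), of 1 "t *\<^sub>R e"] by simp
      show "f (x + t *\<^sub>R e) = 0" if "x \<notin> cbox (-c - t *\<^sub>R e) (c - t *\<^sub>R e)" for x
      proof -
        have "x + t *\<^sub>R e \<notin> cbox (-c) c"
          using that by (auto simp: mem_box algebra_simps)
        then show ?thesis using shift0[of 0] by simp
      qed
    qed auto
    ultimately show ?thesis
      using *(2) by (metis has_integral_unique integral_unique)
  qed
  have "((\<lambda>t. integral (cbox (-c) c) (\<lambda>x. f (x + t *\<^sub>R e))) has_real_derivative
      integral (cbox (-c) c) (\<lambda>x. f' (x + 0 *\<^sub>R e) e)) (at 0 within {-1..1})"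
  proof (rule leibniz_rule_field_derivative)
    show "((\<lambda>t. f (x + t *\<^sub>R e)) has_real_derivative f' (x + t *\<^sub>R e) e) (at t within {-1..1})" for x t
    proof -
      have "((\<lambda>t. x + t *\<^sub>R e) has_derivative (\<lambda>h. h *\<^sub>R e)) (at t)"
        by (auto intro!: derivative_eq_intros)
      from diff_chain_at[OF this der]
      have "((\<lambda>t. f (x + t *\<^sub>R e)) has_derivative (\<lambda>h. f' (x + t *\<^sub>R e) (h *\<^sub>R e))) (at t)"
        by (simp add: o_def)
      moreover have "f' (x + t *\<^sub>R e) (h *\<^sub>R e) = f' (x + t *\<^sub>R e) e * h" for h
        using linear_cmul[OF has_derivative_linear[OF der]] by (simp add: mult.commute)
      ultimately show ?thesis
        by (simp add: has_field_derivative_def has_derivative_at_withinI)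
    qed
    show "(\<lambda>x. f (x + t *\<^sub>R e)) integrable_on cbox (-c) c" for t
      by (intro integrable_continuous continuous_on_compose2[OF contf] continuous_intros) auto
    show "continuous_on ({-1..1} \<times> cbox (-c) c) (\<lambda>(t, x). f' (x + t *\<^sub>R e) e)"
      unfolding split_beta by (intro continuous_on_compose2[OF cont] continuous_intros) auto
  qed auto
  moreover have "((\<lambda>t. integral (cbox (-c) c) (\<lambda>x. f (x + t *\<^sub>R e))) has_real_derivative 0)
      (at 0 within {-1..1})"
    by (rule has_field_derivative_transform_within[of "\<lambda>t. integral UNIV f" _ _ _ 1])
      (auto simp: const)
  ultimately have "integral (cbox (-c) c) (\<lambda>x. f' x e) = 0"
    using DERIV_unique at_within_interior[of "0::real" "{-1..1}"] by (simp add: interior_atLeastAtMost_real)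
  moreover have "f' x e = 0" if "x \<notin> cbox (-c) c" for x
  proof -
    have "((\<lambda>x. 0) has_derivative f' x) (at x)"
      by (rule has_derivative_transform_within_open[OF der, of "- cbox (-c) c"])
        (use that shift0[of 0] in \<open>auto simp: closed_cbox open_Compl\<close>)
    then have "f' x = (\<lambda>h. 0)"
      by (metis has_derivative_const has_derivative_unique)
    then show ?thesis by simp
  qed
  then have "(\<lambda>x. f' x e) = (\<lambda>x. if x \<in> cbox (-c) c then f' x e else 0)" by auto
  ultimately show ?thesis
    by (metis integral_restrict_UNIV)
qed

section \<open>Symmetry of second derivatives\<close>

lemma has_vector_derivative_along_line:
  assumes "(f has_derivative f') (at (p + t *\<^sub>R e))"
  shows "((\<lambda>t. f (p + t *\<^sub>R e)) has_vector_derivative f' e) (at t)"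
proof -
  have "((\<lambda>t. p + t *\<^sub>R e) has_derivative (\<lambda>h. h *\<^sub>R e)) (at t)"
    by (auto intro!: derivative_eq_intros)
  from diff_chain_at[OF this assms]
  have "((\<lambda>t. f (p + t *\<^sub>R e)) has_derivative (\<lambda>h. f' (h *\<^sub>R e))) (at t)"
    by (simp add: o_def)
  then show ?thesis
    using linear_cmul[OF has_derivative_linear[OF assms]] by (simp add: has_vector_derivative_def)
qed

text \<open>Two applications of the mean value theorem identify the second difference with a mixed
  derivative at an intermediate point.\<close>

lemma second_difference_tendsto_mixed_derivative:
  fixes f :: "'a::euclidean_space \<Rightarrow> real"
  assumes "open S" "x \<in> S"
    and f: "\<And>y. y \<in> S \<Longrightarrow> (f has_derivative f' y) (at y)"
    and f': "\<And>y. y \<in> S \<Longrightarrow> ((\<lambda>y. f' y u) has_derivative f'' y) (at y)"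
    and cont: "continuous_on S (\<lambda>y. f'' y v)"
  shows "((\<lambda>h. (f (x + h *\<^sub>R u + h *\<^sub>R v) - f (x + h *\<^sub>R u) - f (x + h *\<^sub>R v) + f x) / h\<^sup>2)
    \<longlongrightarrow> f'' x v) (at_right 0)"
proof (rule tendstoI)
  fix e :: real assume "e > 0"
  have "continuous (at x) (\<lambda>y. f'' y v)"
    using cont assms(1,2) continuous_on_eq_continuous_at by blast
  then obtain d1 where d1: "d1 > 0" "\<And>y. dist y x < d1 \<Longrightarrow> dist (f'' y v) (f'' x v) < e"
    using \<open>e > 0\<close> unfolding continuous_at_eps_delta by blast
  obtain d2 where d2: "d2 > 0" "ball x d2 \<subseteq> S"
    using assms(1,2) open_contains_ball by blast
  let ?d = "min d1 d2 / (norm u + norm v + 1)"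
  have pos: "norm u + norm v + 1 > 0"
    by (smt (verit) norm_ge_zero)
  have "?d > 0"
    using d1 d2 pos by (intro divide_pos_pos) auto
  have near: "dist (x + s *\<^sub>R u + t *\<^sub>R v) x < min d1 d2"
    if "0 \<le> s" "s \<le> h" "0 \<le> t" "t \<le> h" "h < ?d" for s t h
  proof -
    have "norm (s *\<^sub>R u + t *\<^sub>R v) \<le> s * norm u + t * norm v"
      using norm_triangle_ineq[of "s *\<^sub>R u" "t *\<^sub>R v"] that by simp
    also have "\<dots> \<le> h * norm u + h * norm v"
      using that by (intro add_mono mult_right_mono) auto
    also have "\<dots> \<le> h * (norm u + norm v + 1)"
      using that by (simp add: algebra_simps)
    also have "\<dots> < min d1 d2"
      using that(5) pos by (simp add: pos_less_divide_eq)
    finally show ?thesis by (simp add: dist_norm algebra_simps)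
  qed
  show "\<forall>\<^sub>F h in at_right 0. dist ((f (x + h *\<^sub>R u + h *\<^sub>R v) - f (x + h *\<^sub>R u) - f (x + h *\<^sub>R v) + f x) / h\<^sup>2)
      (f'' x v) < e"
    unfolding eventually_at_right_field
  proof (intro exI[of _ ?d] conjI \<open>?d > 0\<close> allI impI)
    fix h assume h: "0 < h" "h < ?d"
    have inS: "x + s *\<^sub>R u + t *\<^sub>R v \<in> S" if "0 \<le> s" "s \<le> h" "0 \<le> t" "t \<le> h" for s t
      using near[OF that h(2)] d2(2) by (auto simp: dist_commute subset_iff)
    let ?g = "\<lambda>s. f ((x + h *\<^sub>R v) + s *\<^sub>R u) - f (x + s *\<^sub>R u)"
    have "\<exists>s>0. s < h \<and> ?g h - ?g 0 =
        (h - 0) * (f' (x + h *\<^sub>R v + s *\<^sub>R u) u - f' (x + s *\<^sub>R u) u)"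
    proof (rule MVT2[OF h(1)])
      fix s assume s: "0 \<le> s" "s \<le> h"
      have *: "x + h *\<^sub>R v + s *\<^sub>R u \<in> S" "x + s *\<^sub>R u \<in> S"
        using inS[of s h] inS[of s 0] s h by (auto simp: algebra_simps)
      show "(?g has_real_derivative f' (x + h *\<^sub>R v + s *\<^sub>R u) u - f' (x + s *\<^sub>R u) u) (at s)"
        using has_vector_derivative_along_line[OF f[OF *(1)]]
          has_vector_derivative_along_line[OF f[OF *(2)]]
        by (intro DERIV_diff) (simp_all add: has_real_derivative_iff_has_vector_derivative)
    qed
    then obtain s where s: "0 < s" "s < h"
      "?g h - ?g 0 = h * (f' (x + h *\<^sub>R v + s *\<^sub>R u) u - f' (x + s *\<^sub>R u) u)" by auto
    have "\<exists>t>0. t < h \<and> f' (x + s *\<^sub>R u + h *\<^sub>R v) u - f' (x + s *\<^sub>R u + 0 *\<^sub>R v) u =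
        (h - 0) * f'' (x + s *\<^sub>R u + t *\<^sub>R v) v"
    proof (rule MVT2[OF h(1)])
      fix t assume t: "0 \<le> t" "t \<le> h"
      have *: "x + s *\<^sub>R u + t *\<^sub>R v \<in> S"
        using inS[of s t] s t by auto
      show "((\<lambda>t. f' (x + s *\<^sub>R u + t *\<^sub>R v) u) has_real_derivative
          f'' (x + s *\<^sub>R u + t *\<^sub>R v) v) (at t)"
        using has_vector_derivative_along_line[OF f'[OF *]]
        by (simp add: has_real_derivative_iff_has_vector_derivative)
    qed
    then obtain t where t: "0 < t" "t < h"
      "f' (x + s *\<^sub>R u + h *\<^sub>R v) u - f' (x + s *\<^sub>R u) u = h * f'' (x + s *\<^sub>R u + t *\<^sub>R v) v"
      by auto
    have "f (x + h *\<^sub>R u + h *\<^sub>R v) - f (x + h *\<^sub>R u) - f (x + h *\<^sub>R v) + f x = ?g h - ?g 0"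
      by (simp add: algebra_simps)
    also have "\<dots> = h\<^sup>2 * f'' (x + s *\<^sub>R u + t *\<^sub>R v) v"
      using s(3) t(3) by (simp add: algebra_simps power2_eq_square)
    finally have "(f (x + h *\<^sub>R u + h *\<^sub>R v) - f (x + h *\<^sub>R u) - f (x + h *\<^sub>R v) + f x) / h\<^sup>2 =
        f'' (x + s *\<^sub>R u + t *\<^sub>R v) v"
      using h(1) by simp
    then show "dist ((f (x + h *\<^sub>R u + h *\<^sub>R v) - f (x + h *\<^sub>R u) - f (x + h *\<^sub>R v) + f x) / h\<^sup>2)
        (f'' x v) < e"
      using d1(2) near[of s h t] s t h by auto
  qed
qed

lemma C2_on_derivative_C1_on:
  assumes "Ck_on (Suc (Suc 0)) f S"
  shows "Ck_on 1 (\<lambda>x. frechet_derivative f (at x) v) S"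
  using assms by simp

lemma C2_on_symmetric_derivatives:
  fixes f :: "'a::euclidean_space \<Rightarrow> 'b::euclidean_space"
  assumes "open S" "Ck_on (Suc (Suc 0)) f S" "x \<in> S"
  shows "frechet_derivative (\<lambda>y. frechet_derivative f (at y) u) (at x) v =
    frechet_derivative (\<lambda>y. frechet_derivative f (at y) v) (at x) u"
proof -
  let ?D = "\<lambda>u v x. frechet_derivative (\<lambda>y. frechet_derivative f (at y) u) (at x) v"
  have "?D u v x \<bullet> w = ?D v u x \<bullet> w" for w
  proof -
    have lim: "((\<lambda>h. (f (x + h *\<^sub>R u + h *\<^sub>R v) \<bullet> w - f (x + h *\<^sub>R u) \<bullet> w - f (x + h *\<^sub>R v) \<bullet> w + f x \<bullet> w) / h\<^sup>2)
        \<longlongrightarrow> ?D u v x \<bullet> w) (at_right 0)" for u v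
    proof (rule second_difference_tendsto_mixed_derivative[OF assms(1,3)])
      fix y assume y: "y \<in> S"
      show "((\<lambda>x. f x \<bullet> w) has_derivative (\<lambda>h. frechet_derivative f (at y) h \<bullet> w)) (at y)"
        by (intro has_derivative_inner_left C1_on_has_derivative[OF Ck_on_Suc_imp_C1_on[OF assms(2)] y])
      show "((\<lambda>y. frechet_derivative f (at y) u \<bullet> w) has_derivative (\<lambda>h. ?D u h y \<bullet> w)) (at y)"
        by (intro has_derivative_inner_left C1_on_has_derivative[OF C2_on_derivative_C1_on[OF assms(2)] y])
    next
      show "continuous_on S (\<lambda>y. ?D u v y \<bullet> w)"
        by (intro continuous_intros C1_on_continuous_derivative[OF C2_on_derivative_C1_on[OF assms(2)]])
    qed
    have "(\<lambda>h. (f (x + h *\<^sub>R u + h *\<^sub>R v) \<bullet> w - f (x + h *\<^sub>R u) \<bullet> w - f (x + h *\<^sub>R v) \<bullet> w + f x \<bullet> w) / h\<^sup>2) =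
        (\<lambda>h. (f (x + h *\<^sub>R v + h *\<^sub>R u) \<bullet> w - f (x + h *\<^sub>R v) \<bullet> w - f (x + h *\<^sub>R u) \<bullet> w + f x \<bullet> w) / h\<^sup>2)"
      by (simp add: algebra_simps)
    then show ?thesis
      using tendsto_unique[OF trivial_limit_at_right_real lim[of u v]] lim[of v u] by simp
  qed
  then show ?thesis by (metis vector_eq_rdot)
qed

section \<open>Stokes' theorem for compactly supported forms in a coordinate domain\<close>

lemma continuous_on_extend_zero:
  fixes f :: "'a::topological_space \<Rightarrow> 'b::real_normed_vector"
  assumes "open V" "closed K" "K \<subseteq> V" "continuous_on V f" "\<And>x. x \<in> V - K \<Longrightarrow> f x = 0"
  shows "continuous_on UNIV (\<lambda>x. if x \<in> V then f x else 0)"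
proof -
  have "continuous_on (V \<union> - K) (\<lambda>x. if x \<in> V then f x else 0)"
  proof (rule continuous_on_open_Un)
    show "continuous_on V (\<lambda>x. if x \<in> V then f x else 0)"
      using assms(4) by (simp cong: continuous_on_cong)
    have "continuous_on (- K) (\<lambda>x. 0::'b)" by simp
    then show "continuous_on (- K) (\<lambda>x. if x \<in> V then f x else 0)"
      by (rule continuous_on_eq) (use assms(5) in auto)
  qed (use assms in auto)
  moreover have "V \<union> - K = UNIV" using assms(3) by auto
  ultimately show ?thesis by simp
qed

lemma C1_on_extend_zero:
  assumes "open V" "closed K" "K \<subseteq> V" "Ck_on 1 f V" "\<And>x. x \<in> V - K \<Longrightarrow> f x = 0"
  shows "Ck_on 1 (\<lambda>x. if x \<in> V then f x else 0) UNIV"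
proof -
  have "Ck_on 1 (\<lambda>x. if x \<in> V then f x else 0) (V \<union> - K)"
  proof (rule C1_on_Un)
    show "Ck_on 1 (\<lambda>x. if x \<in> V then f x else 0) V"
      by (rule C1_on_cong[OF assms(1,4)]) auto
    show "Ck_on 1 (\<lambda>x. if x \<in> V then f x else 0) (- K)"
      by (rule C1_on_cong[OF _ C1_on_const[of _ 0]]) (use assms in auto)
  qed (use assms in auto)
  moreover have "V \<union> - K = UNIV" using assms(3) by auto
  ultimately show ?thesis by (simp only:)
qed

lemma absolutely_integrable_compact_support:
  fixes f :: "'a::euclidean_space \<Rightarrow> real"
  assumes "continuous_on UNIV f" "bounded K" "\<And>x. x \<notin> K \<Longrightarrow> f x = 0"
  shows "f absolutely_integrable_on UNIV"
proof -
  obtain c where c: "K \<subseteq> cbox (-c) c"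
    using assms(2) bounded_subset_cbox_symmetric by blast
  have "f absolutely_integrable_on cbox (-c) c"
    by (rule absolutely_integrable_continuous) (use assms(1) continuous_on_subset in blast)
  then have "(\<lambda>x. if x \<in> cbox (-c) c then f x else 0) absolutely_integrable_on UNIV"
    by (simp only: absolutely_integrable_restrict_UNIV)
  moreover have "(\<lambda>x. if x \<in> cbox (-c) c then f x else 0) = f"
    using assms(3) c by (auto simp: fun_eq_iff)
  ultimately show ?thesis by (simp only:)
qed

lemma frechet_derivative_eq_0_on_open:
  assumes "open U" "x \<in> U" "\<And>y. y \<in> U \<Longrightarrow> f y = 0"
  shows "frechet_derivative f (at x) = (\<lambda>h. 0)"
proof -
  have "(f has_derivative (\<lambda>h. 0)) (at x)"
    by (rule has_derivative_transform_within_open[OF has_derivative_const assms(1,2)]) (simp add: assms)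
  then show ?thesis by (metis frechet_derivative_at)
qed

text \<open>Stokes' theorem in a coordinate domain for the compactly supported 1-form
  \<open>\<langle>B, df\<rangle>\<close>, whose exterior derivative is \<open>\<langle>dB \<and> df\<rangle>\<close>.  As mixed derivatives of f
  commute, the integrand is the difference of a derivative of \<open>\<langle>B, df(v)\<rangle>\<close> along u
  and one of \<open>\<langle>B, df(u)\<rangle>\<close> along v.\<close>

lemma integral_wedge_compact_support_eq_0:
  fixes f B :: "'a::euclidean_space \<Rightarrow> 'b::euclidean_space"
  assumes V: "open V" and K: "compact K" "K \<subseteq> V"
    and B: "Ck_on 1 B V" "\<And>x. x \<in> V - K \<Longrightarrow> B x = 0"
    and f: "Ck_on (Suc (Suc 0)) f V"
  shows "integral V (\<lambda>x. frechet_derivative B (at x) u \<bullet> frechet_derivative f (at x) v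
      - frechet_derivative B (at x) v \<bullet> frechet_derivative f (at x) u) = 0"
proof -
  define F where "F = (\<lambda>v x. if x \<in> V then B x \<bullet> frechet_derivative f (at x) v else 0)"
  have clK: "closed K" using K compact_imp_closed by blast
  have F0: "F v x = 0" if "x \<notin> K" for v x
    using that B(2) by (auto simp: F_def)
  have C1: "Ck_on 1 (F v) UNIV" for v
    unfolding F_def
    by (rule C1_on_extend_zero[OF V clK K(2)])
      (simp_all only: B(2) inner_zero_left
        C1_on_bounded_bilinear[OF bounded_bilinear_inner V B(1) C2_on_derivative_C1_on[OF f]])
  have D0: "frechet_derivative (F v) (at x) u = 0" if "x \<notin> K" for u v x
    using frechet_derivative_eq_0_on_open[OF open_Compl[OF clK], of x "F v"] F0 that by simp
  have int0: "integral UNIV (\<lambda>x. frechet_derivative (F v) (at x) u) = 0" for u v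
    by (rule integral_directional_derivative_eq_0[OF C1_on_has_derivative[OF C1 UNIV_I]
          C1_on_continuous_derivative[OF C1] compact_imp_bounded[OF K(1)] F0])
  have abs: "(\<lambda>x. frechet_derivative (F v) (at x) u) absolutely_integrable_on UNIV" for u v
    by (rule absolutely_integrable_compact_support[OF C1_on_continuous_derivative[OF C1]
          compact_imp_bounded[OF K(1)] D0])
  have DF: "frechet_derivative (F v) (at x) u = frechet_derivative B (at x) u \<bullet> frechet_derivative f (at x) v
      + B x \<bullet> frechet_derivative (\<lambda>x. frechet_derivative f (at x) v) (at x) u" if "x \<in> V" for u v x
  proof -
    have "((\<lambda>x. B x \<bullet> frechet_derivative f (at x) v) has_derivative
        (\<lambda>h. B x \<bullet> frechet_derivative (\<lambda>x. frechet_derivative f (at x) v) (at x) h +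
          frechet_derivative B (at x) h \<bullet> frechet_derivative f (at x) v)) (at x)"
      by (intro has_derivative_inner C1_on_has_derivative[OF B(1) that]
          C1_on_has_derivative[OF C2_on_derivative_C1_on[OF f] that])
    then have "(F v has_derivative
        (\<lambda>h. B x \<bullet> frechet_derivative (\<lambda>x. frechet_derivative f (at x) v) (at x) h +
          frechet_derivative B (at x) h \<bullet> frechet_derivative f (at x) v)) (at x)"
      by (rule has_derivative_transform_within_open[OF _ V that]) (simp add: F_def)
    from frechet_derivative_at[OF this, symmetric] show ?thesis by simp
  qed
  have "0 = integral UNIV (\<lambda>x. frechet_derivative (F v) (at x) u - frechet_derivative (F u) (at x) v)"
    using abs by (subst integral_diff) (auto simp: int0 absolutely_integrable_on_def)
  also have "(\<lambda>x. frechet_derivative (F v) (at x) u - frechet_derivative (F u) (at x) v) =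
     (\<lambda>x. if x \<in> V then frechet_derivative B (at x) u \<bullet> frechet_derivative f (at x) v
      - frechet_derivative B (at x) v \<bullet> frechet_derivative f (at x) u else 0)"
  proof
    fix x
    show "frechet_derivative (F v) (at x) u - frechet_derivative (F u) (at x) v =
        (if x \<in> V then frechet_derivative B (at x) u \<bullet> frechet_derivative f (at x) v
          - frechet_derivative B (at x) v \<bullet> frechet_derivative f (at x) u else 0)"
    proof (cases "x \<in> V")
      case True
      show ?thesis
        using C2_on_symmetric_derivatives[OF V f True, of u v] by (simp add: True DF)
    next
      case False
      then have "x \<notin> K" using K(2) by blast
      with False show ?thesis by (simp add: D0)
    qed
  qed
  finally show ?thesis by (simp only: integral_restrict_UNIV)
qed

section \<open>Linear algebra of an oriented plane in 3-space\<close>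

text \<open>A bilinear form on the plane enters only through its alternating part, which is a multiple of the
  determinant.  This governs all changes of charts below.\<close>

lemma alternating_form_R2:
  fixes B :: "real^2 \<Rightarrow> real^2 \<Rightarrow> 'b::real_vector"
  assumes "bilinear B"
  shows "B u w - B w u =
    (u$1 * w$2 - u$2 * w$1) *\<^sub>R (B (axis 1 1) (axis 2 1) - B (axis 2 1) (axis 1 1))"
proof -
  have ex: "x = x$1 *\<^sub>R axis 1 1 + x$2 *\<^sub>R axis 2 1" for x :: "real^2"
    by (simp add: vec_eq_iff forall_2 axis_def)
  show ?thesis
    apply (subst (1 2) ex[of u])
    apply (subst (1 2) ex[of w])
    by (simp add: bilinear_ladd[OF assms] bilinear_radd[OF assms] bilinear_lmul[OF assms]
        bilinear_rmul[OF assms] algebra_simps)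
qed

lemma det_matrix_R2:
  fixes T :: "real^2 \<Rightarrow> real^2"
  shows "det (matrix T) = T (axis 1 1) $ 1 * T (axis 2 1) $ 2 - T (axis 1 1) $ 2 * T (axis 2 1) $ 1"
  by (simp add: det_2 matrix_def mult.commute)

lemma bilinear_comp_linear:
  assumes "bilinear B" "linear P" "linear Q"
  shows "bilinear (\<lambda>u w. B (P u) (Q w))"
  using assms unfolding bilinear_def by (auto intro: linear_compose[unfolded o_def])

lemma orthonormal_frame_R3:
  fixes n a b :: "real^3"
  assumes "norm n = 1" "norm a = 1" "norm b = 1" "n \<bullet> a = 0" "n \<bullet> b = 0" "a \<bullet> b = 0"
    and "n \<bullet> z = 0"
  shows "z = (z \<bullet> a) *\<^sub>R a + (z \<bullet> b) *\<^sub>R b"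
proof -
  have sq: "n \<bullet> n = 1" "a \<bullet> a = 1" "b \<bullet> b = 1"
    using assms by (auto simp: norm_eq_1)
  have distinct: "n \<noteq> a" "n \<noteq> b" "a \<noteq> b" using assms sq by auto
  have orth: "pairwise orthogonal {n, a, b}"
    using assms by (auto simp: pairwise_def orthogonal_def inner_commute)
  have "independent {n, a, b}"
    by (rule pairwise_orthogonal_independent[OF orth]) (use sq in auto)
  then have "UNIV \<subseteq> span {n, a, b}"
    by (intro card_ge_dim_independent) (use distinct in auto)
  then have "z \<in> span {n, a, b}" by (rule subsetD) simp
  have "(\<Sum>x\<in>{n, a, b}. (z \<bullet> x) *\<^sub>R x) = z"
    by (rule orthonormal_basis_expand[OF orth _ \<open>z \<in> _\<close>]) (use assms in auto)
  then show ?thesis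
    using distinct assms by (simp add: inner_commute)
qed

text \<open>For this reason the gradient in space of a function is normal to a surface at a critical point of its
  restriction.\<close>

lemma orthogonal_plane_eq_multiple:
  fixes n a b :: "real^3"
  assumes "norm n = 1" "norm a = 1" "norm b = 1" "n \<bullet> a = 0" "n \<bullet> b = 0" "a \<bullet> b = 0"
    and "z \<bullet> a = 0" "z \<bullet> b = 0"
  shows "z = (z \<bullet> n) *\<^sub>R n"
  using orthonormal_frame_R3[OF assms(1-6), of "z - (z \<bullet> n) *\<^sub>R n"] assms
  by (simp add: inner_diff_left inner_diff_right norm_eq_1 inner_commute)

lemma cross3_orthonormal_nonzero:
  assumes "norm a = 1" "norm b = 1" "a \<bullet> b = 0"
  shows "cross3 a b \<noteq> 0"
  using norm_cross_dot[of a b] assms by auto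

text \<open>The spectral theorem for the endomorphism \<open>- Q \<circ> P\<^sup>-\<^sup>1\<close> of the plane orthogonal to n: rotating
  an orthonormal basis through half the angle of a vector orthogonal to (off-diagonal entry,
  half the difference of the diagonal entries) diagonalises the matrix.\<close>

lemma exists_principal_directions:
  fixes P Q :: "real^2 \<Rightarrow> real^3"
  assumes "linear P" "inj P" "linear Q" "norm n = 1"
    and nP: "\<And>u. n \<bullet> P u = 0" and nQ: "\<And>u. n \<bullet> Q u = 0"
    and sym: "\<And>u w. Q u \<bullet> P w = Q w \<bullet> P u"
  obtains u1 u2 k1 k2 where "norm (P u1) = 1" "norm (P u2) = 1" "P u1 \<bullet> P u2 = 0"
    "Q u1 = - k1 *\<^sub>R P u1" "Q u2 = - k2 *\<^sub>R P u2"
proof -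
  note lin = linear_add[OF assms(1)] linear_cmul[OF assms(1)] linear_diff[OF assms(1)]
    linear_add[OF assms(3)] linear_cmul[OF assms(3)]
  have nz: "P u \<noteq> 0" if "u \<noteq> 0" for u
    using that assms(1,2) by (metis linear_injective_0)
  let ?e = "axis 1 1 :: real^2" let ?e' = "axis 2 1 :: real^2"
  define w1 where "w1 = inverse (norm (P ?e)) *\<^sub>R ?e"
  define y where "y = ?e' - (P ?e' \<bullet> P w1) *\<^sub>R w1"
  define w2 where "w2 = inverse (norm (P y)) *\<^sub>R y"
  have 1: "norm (P w1) = 1"
    using nz[of ?e] by (simp add: w1_def lin)
  have "y $ 2 = 1" by (simp add: y_def w1_def axis_def)
  then have "y \<noteq> 0" by auto
  then have 2: "norm (P w2) = 1"
    using nz by (simp add: w2_def lin)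
  have "P y \<bullet> P w1 = 0"
    using 1 by (simp add: y_def lin inner_diff_left norm_eq_1)
  then have 12: "P w1 \<bullet> P w2 = 0"
    by (simp add: w2_def lin inner_commute)
  define b where "b = Q w1 \<bullet> P w2"
  define d where "d = (Q w2 \<bullet> P w2 - Q w1 \<bullet> P w1) / 2"
  obtain X Y where XY: "X\<^sup>2 + Y\<^sup>2 = 1" "b * X + d * Y = 0"
  proof (cases "b = 0 \<and> d = 0")
    case True
    then show ?thesis using that[of 1 0] by simp
  next
    case False
    define r where "r = sqrt (b\<^sup>2 + d\<^sup>2)"
    have r: "r\<^sup>2 = b\<^sup>2 + d\<^sup>2" "r \<noteq> 0"
      using False by (auto simp: r_def sum_power2_eq_zero_iff)
    show ?thesis
    proof (rule that[of "- d / r" "b / r"])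
      have "(- d / r)\<^sup>2 + (b / r)\<^sup>2 = (b\<^sup>2 + d\<^sup>2) / r\<^sup>2"
        by (simp add: power_divide add_divide_distrib)
      also have "\<dots> = 1" using r by (metis divide_self power_eq_0_iff add.commute)
      finally show "(- d / r)\<^sup>2 + (b / r)\<^sup>2 = 1" .
    qed (simp add: field_simps)
  qed
  obtain t where t: "X = cos t" "Y = sin t"
    using sincos_total_2pi_le[OF XY(1)] by metis
  define c s where "c = cos (t/2)" and "s = sin (t/2)"
  have cs: "c\<^sup>2 + s\<^sup>2 = 1" by (simp add: c_def s_def)
  have "X = c\<^sup>2 - s\<^sup>2" "Y = 2 * s * c"
    using cos_double[of "t/2"] sin_double[of "t/2"] by (auto simp: t c_def s_def)
  with XY have rot: "b * (c\<^sup>2 - s\<^sup>2) + 2 * d * s * c = 0" by simp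
  define u1 where "u1 = c *\<^sub>R w1 + s *\<^sub>R w2"
  define u2 where "u2 = - s *\<^sub>R w1 + c *\<^sub>R w2"
  have ip: "P w1 \<bullet> P w1 = 1" "P w2 \<bullet> P w2 = 1" "P w2 \<bullet> P w1 = 0"
    using 1 2 12 by (auto simp: norm_eq_1 inner_commute)
  have U: "norm (P u1) = 1" "norm (P u2) = 1" "P u1 \<bullet> P u2 = 0"
    using cs 12 ip by (auto simp: u1_def u2_def norm_eq_1 lin inner_add_left inner_add_right
        power2_eq_square algebra_simps)
  have b': "Q w2 \<bullet> P w1 = b" using sym b_def by simp
  have off: "Q u1 \<bullet> P u2 = 0"
  proof -
    have "Q u1 \<bullet> P u2 = b * (c\<^sup>2 - s\<^sup>2) + 2 * d * s * c"
      by (simp add: u1_def u2_def lin inner_add_left inner_add_right inner_diff_right b' b_def[symmetric] d_def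
          power2_eq_square field_simps)
    then show ?thesis using rot by simp
  qed
  have frame: "Q u = (Q u \<bullet> P u1) *\<^sub>R P u1 + (Q u \<bullet> P u2) *\<^sub>R P u2" for u
    by (rule orthonormal_frame_R3[OF assms(4) U(1,2) nP nP U(3) nQ])
  have Q1: "Q u1 = (Q u1 \<bullet> P u1) *\<^sub>R P u1" and Q2: "Q u2 = (Q u2 \<bullet> P u2) *\<^sub>R P u2"
    using off sym[of u2 u1] by (auto intro!: trans[OF frame])
  show ?thesis
    by (rule that[OF U, of "- (Q u1 \<bullet> P u1)" "- (Q u2 \<bullet> P u2)"])
      (simp_all add: Q1[symmetric] Q2[symmetric])
qed

text \<open>Both sides are alternating in (u, w), so it suffices to compare them on the principal
  directions.\<close>

lemma wedge_eq_trace_principal: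
  fixes P Q :: "real^2 \<Rightarrow> real^3"
  assumes "linear P" "linear Q"
    and U: "norm (P u1) = 1" "norm (P u2) = 1" "P u1 \<bullet> P u2 = 0"
    and k: "Q u1 = - k1 *\<^sub>R P u1" "Q u2 = - k2 *\<^sub>R P u2"
  shows "cross3 (Q u) (P w) - cross3 (Q w) (P u) = - (k1 + k2) *\<^sub>R cross3 (P u) (P w)"
proof -
  have bilP: "bilinear (\<lambda>u w. cross3 (P u) (P w))" and bilQ: "bilinear (\<lambda>u w. cross3 (Q u) (P w))"
    by (auto intro!: bilinear_comp_linear bilinear_cross assms)
  define EP where "EP = cross3 (P (axis 1 1)) (P (axis 2 1)) - cross3 (P (axis 2 1)) (P (axis 1 1))"
  define EQ where "EQ = cross3 (Q (axis 1 1)) (P (axis 2 1)) - cross3 (Q (axis 2 1)) (P (axis 1 1))"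
  define \<delta> where "\<delta> = (\<lambda>(u :: real^2) (w :: real^2). u$1 * w$2 - u$2 * w$1)"
  have P: "2 *\<^sub>R cross3 (P u) (P w) = \<delta> u w *\<^sub>R EP" for u w
    using alternating_form_R2[OF bilP, of u w] cross_skew[of "P w" "P u"]
    by (simp add: EP_def \<delta>_def scaleR_2)
  have Q: "cross3 (Q u) (P w) - cross3 (Q w) (P u) = \<delta> u w *\<^sub>R EQ" for u w
    using alternating_form_R2[OF bilQ, of u w] by (simp add: EQ_def \<delta>_def)
  have "2 *\<^sub>R (\<delta> u1 u2 *\<^sub>R EQ) = 2 *\<^sub>R (- (k1 + k2) *\<^sub>R cross3 (P u1) (P u2))"
    unfolding Q[symmetric] k using cross_skew[of "P u2" "P u1"]
    by (simp add: cross_mult_left algebra_simps)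
  also have "\<dots> = \<delta> u1 u2 *\<^sub>R (- (k1 + k2) *\<^sub>R EP)"
    by (subst (1 2) scaleR_left_commute) (simp only: P)
  finally have "\<delta> u1 u2 *\<^sub>R (2 *\<^sub>R EQ) = \<delta> u1 u2 *\<^sub>R (- (k1 + k2) *\<^sub>R EP)"
    by (simp only: scaleR_left_commute)
  moreover have "\<delta> u1 u2 \<noteq> 0"
    using P[of u1 u2] cross3_orthonormal_nonzero[OF U] by auto
  ultimately have "2 *\<^sub>R EQ = - (k1 + k2) *\<^sub>R EP"
    by (simp only: real_vector.scale_cancel_left) simp
  then have "2 *\<^sub>R (cross3 (Q u) (P w) - cross3 (Q w) (P u)) =
      2 *\<^sub>R (- (k1 + k2) *\<^sub>R cross3 (P u) (P w))"
    unfolding Q by (subst (1 2) scaleR_left_commute) (simp only: P scaleR_left_commute[of _ "\<delta> u w"])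
  then show ?thesis by (simp only: real_vector.scale_cancel_left) simp
qed

section \<open>Charts of a surface\<close>

text \<open>From here on functions of class C^1 are handled by the closure properties above.\<close>

declare Ck_on.simps [simp del]

abbreviation chart_range :: "'a chart \<Rightarrow> (real^2) set" where
  "chart_range c \<equiv> chart_map c ` chart_dom c"

abbreviation chart_inv :: "'a chart \<Rightarrow> real^2 \<Rightarrow> 'a" where
  "chart_inv c \<equiv> inv_into (chart_dom c) (chart_map c)"

definition C1_map :: "'a chart set \<Rightarrow> ('a \<Rightarrow> 'b::real_normed_vector) \<Rightarrow> bool" where
  "C1_map A f \<longleftrightarrow> (\<forall>c\<in>A. Ck_on 1 (in_chart c f) (chart_range c))"

text \<open>In a Hausdorff space the closed balls of charts are closed sets, so that functions supported in one
  of them extend by zero to the whole surface.\<close>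

locale surface =
  fixes M :: "'a topology" and A :: "'a chart set"
  assumes atlas: "smooth_atlas M A" and hausdorff: "Hausdorff_space M"
begin

lemma topspace_eq: "topspace M = (\<Union>c\<in>A. chart_dom c)"
  using atlas by (simp add: smooth_atlas_def)

lemma openin_chart_dom: "c \<in> A \<Longrightarrow> openin M (chart_dom c)"
  using atlas by (auto simp: smooth_atlas_def is_chart_def)

lemma open_chart_range: "c \<in> A \<Longrightarrow> open (chart_range c)"
  using atlas by (auto simp: smooth_atlas_def is_chart_def)

lemma homeomorphic_chart:
  "c \<in> A \<Longrightarrow> homeomorphic_map (subtopology M (chart_dom c)) (top_of_set (chart_range c)) (chart_map c)"
  using atlas by (auto simp: smooth_atlas_def is_chart_def)

lemma chart_dom_subset: "c \<in> A \<Longrightarrow> chart_dom c \<subseteq> topspace M"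
  using topspace_eq by auto

lemma topspace_chart: "c \<in> A \<Longrightarrow> topspace (subtopology M (chart_dom c)) = chart_dom c"
  using chart_dom_subset by (simp add: topspace_subtopology Int_absorb1)

lemma inj_on_chart: "c \<in> A \<Longrightarrow> inj_on (chart_map c) (chart_dom c)"
  using homeomorphic_imp_injective_map[OF homeomorphic_chart] by (simp only: topspace_chart)

lemma chart_inv_chart [simp]: "c \<in> A \<Longrightarrow> p \<in> chart_dom c \<Longrightarrow> chart_inv c (chart_map c p) = p"
  using inj_on_chart by simp

lemma chart_chart_inv: "x \<in> chart_range c \<Longrightarrow> chart_map c (chart_inv c x) = x"
  by (rule f_inv_into_f)

lemma chart_inv_in_dom: "x \<in> chart_range c \<Longrightarrow> chart_inv c x \<in> chart_dom c"
  by (rule inv_into_into)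

lemma in_chart_chart [simp]: "c \<in> A \<Longrightarrow> p \<in> chart_dom c \<Longrightarrow> in_chart c f (chart_map c p) = f p"
  by (simp add: in_chart_def)

lemma in_chart_eq: "in_chart c f x = f (chart_inv c x)"
  by (simp add: in_chart_def)

lemma open_chart_image:
  assumes "c \<in> A" "openin M U"
  shows "open (chart_map c ` (chart_dom c \<inter> U))"
proof -
  have "openin (subtopology M (chart_dom c)) (chart_dom c \<inter> U)"
    using assms(2) by (auto simp: openin_subtopology)
  then have "openin (top_of_set (chart_range c)) (chart_map c ` (chart_dom c \<inter> U))"
    using homeomorphic_imp_open_map[OF homeomorphic_chart[OF assms(1)]] by (auto simp: open_map_def)
  then show ?thesis
    using open_chart_range[OF assms(1)] by (simp add: openin_open_eq)
qed

lemma openin_chart_inv_image: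
  assumes "c \<in> A" "open W" "W \<subseteq> chart_range c"
  shows "openin M (chart_inv c ` W)"
proof -
  have "openin (top_of_set (chart_range c)) W"
    using assms(2,3) by (simp add: open_subset)
  then have "openin (subtopology M (chart_dom c)) {p \<in> chart_dom c. chart_map c p \<in> W}"
    using openin_continuous_map_preimage[OF homeomorphic_imp_continuous_map[OF homeomorphic_chart[OF assms(1)]]]
    by (simp only: topspace_chart[OF assms(1)])
  moreover have "{p \<in> chart_dom c. chart_map c p \<in> W} = chart_inv c ` W"
  proof
    show "{p \<in> chart_dom c. chart_map c p \<in> W} \<subseteq> chart_inv c ` W"
    proof
      fix p assume "p \<in> {p \<in> chart_dom c. chart_map c p \<in> W}"
      then show "p \<in> chart_inv c ` W"
        using chart_inv_chart[OF assms(1), of p] by (intro image_eqI[where x = "chart_map c p"]) simp_all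
    qed
    show "chart_inv c ` W \<subseteq> {p \<in> chart_dom c. chart_map c p \<in> W}"
    proof
      fix p assume "p \<in> chart_inv c ` W"
      then obtain x where x: "x \<in> W" "p = chart_inv c x" by blast
      with assms(3) have "x \<in> chart_range c" by blast
      then show "p \<in> {p \<in> chart_dom c. chart_map c p \<in> W}"
        using x chart_chart_inv[of x c] chart_inv_in_dom[of x c] by simp
    qed
  qed
  ultimately show ?thesis
    using openin_trans_full[OF _ openin_chart_dom[OF assms(1)]] by simp
qed

lemma compactin_chart_inv_image:
  assumes "c \<in> A" "compact K" "K \<subseteq> chart_range c"
  shows "compactin M (chart_inv c ` K)"
proof -
  obtain g where g: "homeomorphic_maps (subtopology M (chart_dom c)) (top_of_set (chart_range c)) (chart_map c) g"
    using homeomorphic_chart[OF assms(1)] homeomorphic_map_maps by blast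
  then have g': "continuous_map (top_of_set (chart_range c)) M g"
    by (auto simp: homeomorphic_maps_def continuous_map_in_subtopology)
  have "chart_inv c x = g x" if "x \<in> chart_range c" for x
  proof -
    from that obtain p where p: "p \<in> chart_dom c" "x = chart_map c p" by blast
    then have "g x = p" using g topspace_chart[OF assms(1)] by (auto simp: homeomorphic_maps_def)
    then show ?thesis using p assms(1) by simp
  qed
  then have "chart_inv c ` K = g ` K" using assms(3) by (auto simp: subset_iff)
  moreover have "compactin (top_of_set (chart_range c)) K"
    using assms(2,3) by (simp add: compactin_subtopology)
  ultimately show ?thesis using image_compactin[OF _ g'] by simp
qed

lemma continuous_map_from_charts:
  assumes "\<And>c. c \<in> A \<Longrightarrow> continuous_on (chart_range c) (in_chart c f)"
  shows "continuous_map M euclidean f"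
proof -
  have "openin M {p \<in> topspace M. f p \<in> U}" if "open U" for U
  proof -
    have "{p \<in> topspace M. f p \<in> U} = (\<Union>c\<in>A. chart_inv c ` {x \<in> chart_range c. in_chart c f x \<in> U})"
    proof
      show "{p \<in> topspace M. f p \<in> U} \<subseteq> (\<Union>c\<in>A. chart_inv c ` {x \<in> chart_range c. in_chart c f x \<in> U})"
      proof
        fix p assume "p \<in> {p \<in> topspace M. f p \<in> U}"
        then obtain c where "c \<in> A" "p \<in> chart_dom c" "f p \<in> U" using topspace_eq by blast
        then show "p \<in> (\<Union>c\<in>A. chart_inv c ` {x \<in> chart_range c. in_chart c f x \<in> U})"
          by (intro UN_I[of c] image_eqI[where x = "chart_map c p"]) simp_all
      qed
      show "(\<Union>c\<in>A. chart_inv c ` {x \<in> chart_range c. in_chart c f x \<in> U}) \<subseteq> {p \<in> topspace M. f p \<in> U}"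
      proof
        fix p assume "p \<in> (\<Union>c\<in>A. chart_inv c ` {x \<in> chart_range c. in_chart c f x \<in> U})"
        then obtain c x where "c \<in> A" "x \<in> chart_range c" "in_chart c f x \<in> U" "p = chart_inv c x"
          by blast
        then show "p \<in> {p \<in> topspace M. f p \<in> U}"
          using chart_inv_in_dom[of x c] chart_dom_subset[of c] by (simp add: in_chart_eq subset_iff)
      qed
    qed
    moreover have "openin M (chart_inv c ` {x \<in> chart_range c. in_chart c f x \<in> U})" if c: "c \<in> A" for c
    proof (rule openin_chart_inv_image[OF c])
      have "open (in_chart c f -` U \<inter> chart_range c)"
        using assms[OF c] \<open>open U\<close> continuous_on_open_vimage[OF open_chart_range[OF c]] by blast
      then show "open {x \<in> chart_range c. in_chart c f x \<in> U}"
        by (simp add: vimage_def Int_def conj_commute)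
    qed auto
    moreover have "openin M (\<Union>c\<in>A. chart_inv c ` {x \<in> chart_range c. in_chart c f x \<in> U})"
      using calculation(2) by (intro openin_Union) blast
    ultimately show ?thesis by (simp only:)
  qed
  then show ?thesis by (simp add: continuous_map_def)
qed

subsection \<open>Maps of class C^1\<close>

lemma C1_map_imp_C1_on: "C1_map A f \<Longrightarrow> c \<in> A \<Longrightarrow> Ck_on 1 (in_chart c f) (chart_range c)"
  by (simp add: C1_map_def)

lemma smooth_map_imp_C2_on:
  "smooth_map A f \<Longrightarrow> c \<in> A \<Longrightarrow> Ck_on (Suc (Suc 0)) (in_chart c f) (chart_range c)"
  by (simp add: smooth_map_def smooth_on_def)

lemma smooth_map_imp_C1_map: "smooth_map A f \<Longrightarrow> C1_map A f"
  by (auto simp only: smooth_map_def smooth_on_def C1_map_def)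

lemma C1_map_continuous_on: "C1_map A f \<Longrightarrow> c \<in> A \<Longrightarrow> continuous_on (chart_range c) (in_chart c f)"
  by (rule C1_on_imp_continuous_on[OF C1_map_imp_C1_on])

lemma C1_map_bounded_bilinear:
  "bounded_bilinear B \<Longrightarrow> C1_map A f \<Longrightarrow> C1_map A g \<Longrightarrow> C1_map A (\<lambda>p. B (f p) (g p))"
  unfolding C1_map_def in_chart_def o_def
  by (rule ballI, rule C1_on_bounded_bilinear) (simp_all add: open_chart_range)

lemma C1_map_bounded_linear: "bounded_linear L \<Longrightarrow> C1_map A f \<Longrightarrow> C1_map A (\<lambda>p. L (f p))"
  unfolding C1_map_def in_chart_def o_def
  by (rule ballI, rule C1_on_bounded_linear) (simp_all add: open_chart_range)

lemma C1_map_add: "C1_map A f \<Longrightarrow> C1_map A g \<Longrightarrow> C1_map A (\<lambda>p. f p + g p)"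
  unfolding C1_map_def in_chart_def o_def
  by (rule ballI, rule C1_on_add) (simp_all add: open_chart_range)

lemma C1_map_sum: "finite I \<Longrightarrow> (\<And>i. i \<in> I \<Longrightarrow> C1_map A (f i)) \<Longrightarrow> C1_map A (\<lambda>p. \<Sum>i\<in>I. f i p)"
  unfolding C1_map_def in_chart_def o_def
  by (rule ballI, rule C1_on_sum) (simp_all add: open_chart_range)

lemma C1_map_inverse:
  fixes f :: "'a \<Rightarrow> real"
  assumes "C1_map A f" "\<And>p. p \<in> topspace M \<Longrightarrow> f p \<noteq> 0"
  shows "C1_map A (\<lambda>p. inverse (f p))"
  unfolding C1_map_def in_chart_def o_def
proof (intro ballI C1_on_inverse open_chart_range)
  fix c x assume "c \<in> A" "x \<in> chart_range c"
  then show "f (chart_inv c x) \<noteq> 0"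
    using assms(2) chart_inv_in_dom[of x c] chart_dom_subset[of c] by blast
qed (use assms(1) in \<open>auto simp only: C1_map_def in_chart_def o_def\<close>)

lemma chart_deriv_works:
  assumes "C1_map A f" "c \<in> A" "p \<in> chart_dom c"
  shows "(in_chart c f has_derivative chart_deriv c f p) (at (chart_map c p))"
  unfolding chart_deriv_def
  using C1_on_has_derivative[OF C1_map_imp_C1_on[OF assms(1,2)]] assms(3) by blast

lemma linear_chart_deriv:
  assumes "C1_map A f" "c \<in> A" "p \<in> chart_dom c"
  shows "linear (chart_deriv c f p)"
  using chart_deriv_works[OF assms] by (rule has_derivative_linear)

lemma chart_deriv_eqI:
  assumes "(in_chart c f has_derivative f') (at (chart_map c p))"
  shows "chart_deriv c f p = f'"
  unfolding chart_deriv_def using frechet_derivative_at[OF assms] by simp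

lemma chart_deriv_cong:
  assumes "c \<in> A" "p \<in> chart_dom c" "openin M U" "p \<in> U" "\<And>q. q \<in> U \<Longrightarrow> f q = g q"
    and "C1_map A g"
  shows "chart_deriv c f p = chart_deriv c g p"
proof (rule chart_deriv_eqI, rule has_derivative_transform_within_open)
  show "(in_chart c g has_derivative chart_deriv c g p) (at (chart_map c p))"
    by (rule chart_deriv_works[OF assms(6,1,2)])
  show "open (chart_map c ` (chart_dom c \<inter> U))"
    by (rule open_chart_image[OF assms(1,3)])
  show "chart_map c p \<in> chart_map c ` (chart_dom c \<inter> U)"
    using assms by blast
  show "in_chart c g x = in_chart c f x" if "x \<in> chart_map c ` (chart_dom c \<inter> U)" for x
    using that assms(1,5) by auto
qed

lemma chart_deriv_continuous_on:
  assumes "C1_map A f" "c \<in> A"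
  shows "continuous_on (chart_range c) (\<lambda>x. chart_deriv c f (chart_inv c x) v)"
proof (rule continuous_on_eq)
  show "continuous_on (chart_range c) (\<lambda>x. frechet_derivative (in_chart c f) (at x) v)"
    by (rule C1_on_continuous_derivative[OF C1_map_imp_C1_on[OF assms]])
qed (simp add: chart_deriv_def chart_chart_inv)

subsection \<open>Change of charts\<close>

lemma C1_on_transition:
  assumes "c \<in> A" "d \<in> A"
  shows "Ck_on 1 (in_chart c (chart_map d)) (chart_map c ` (chart_dom c \<inter> chart_dom d))"
  using atlas assms unfolding smooth_atlas_def smooth_on_def by blast

lemma open_overlap: "c \<in> A \<Longrightarrow> d \<in> A \<Longrightarrow> open (chart_map c ` (chart_dom c \<inter> chart_dom d))"
  by (rule open_chart_image[OF _ openin_chart_dom])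

lemma transition_has_derivative:
  assumes "c \<in> A" "d \<in> A" "p \<in> chart_dom c" "p \<in> chart_dom d"
  shows "(in_chart c (chart_map d) has_derivative chart_deriv c (chart_map d) p) (at (chart_map c p))"
  unfolding chart_deriv_def
  using C1_on_has_derivative[OF C1_on_transition[OF assms(1,2)]] assms(3,4) by blast

lemma chart_deriv_transition:
  assumes "C1_map A f" "c \<in> A" "d \<in> A" "p \<in> chart_dom c" "p \<in> chart_dom d"
  shows "chart_deriv c f p u = chart_deriv d f p (chart_deriv c (chart_map d) p u)"
proof -
  have "(in_chart d f has_derivative chart_deriv d f p) (at (in_chart c (chart_map d) (chart_map c p)))"
    using chart_deriv_works[OF assms(1,3,5)] assms(2,4) by simp
  from diff_chain_at[OF transition_has_derivative[OF assms(2-5)] this]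
  have "(in_chart c f has_derivative chart_deriv d f p \<circ> chart_deriv c (chart_map d) p) (at (chart_map c p))"
  proof (rule has_derivative_transform_within_open[OF _ open_overlap[OF assms(2,3)]])
    show "chart_map c p \<in> chart_map c ` (chart_dom c \<inter> chart_dom d)"
      using assms by blast
  qed (use assms in auto)
  then show ?thesis by (simp add: chart_deriv_eqI)
qed

definition chart_bump :: "'a chart \<Rightarrow> real^2 \<Rightarrow> real \<Rightarrow> 'a \<Rightarrow> real" where
  "chart_bump c a r p = (if p \<in> chart_dom c then bump a r (chart_map c p) else 0)"

lemma chart_bump_nonneg: "chart_bump c a r p \<ge> 0"
  by (simp add: chart_bump_def bump_nonneg)

lemma chart_bump_pos:
  assumes "c \<in> A" "r > 0" "ball a r \<subseteq> chart_range c"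
  shows "chart_bump c a r p > 0 \<longleftrightarrow> p \<in> chart_inv c ` ball a r"
proof
  assume "chart_bump c a r p > 0"
  then have "p \<in> chart_dom c" "chart_map c p \<in> ball a r"
    using assms(2) by (auto simp: chart_bump_def bump_pos_iff split: if_splits)
  then show "p \<in> chart_inv c ` ball a r"
    using assms(1) by (intro image_eqI[where x = "chart_map c p"]) simp_all
next
  assume "p \<in> chart_inv c ` ball a r"
  then obtain x where x: "x \<in> ball a r" "p = chart_inv c x" by blast
  with assms(3) have "x \<in> chart_range c" by blast
  then have "p \<in> chart_dom c" "chart_map c p = x"
    using x chart_inv_in_dom[of x c] chart_chart_inv[of x c] by simp_all
  then show "chart_bump c a r p > 0"
    using x assms(2) by (simp add: chart_bump_def bump_pos_iff)
qed

lemma closedin_chart_inv_cball: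
  assumes "c \<in> A" "cball a r \<subseteq> chart_range c"
  shows "closedin M (chart_inv c ` cball a r)"
  using compactin_imp_closedin[OF hausdorff compactin_chart_inv_image[OF assms(1) _ assms(2)]] by simp

lemma chart_bump_eq_0:
  assumes "c \<in> A" "r > 0" "cball a r \<subseteq> chart_range c" "p \<notin> chart_inv c ` cball a r"
  shows "chart_bump c a r p = 0"
proof -
  have sub: "ball a r \<subseteq> cball a r" by auto
  then have "\<not> chart_bump c a r p > 0"
    using chart_bump_pos[OF assms(1,2) order_trans[OF sub assms(3)], of p] assms(4) by blast
  then show ?thesis using chart_bump_nonneg[of c a r p] by linarith
qed

text \<open>In another chart the function is a bump composed with the transition map on the overlap, and zero
  on the complement of the closed ball; these two open sets cover the chart.\<close>

lemma C1_map_chart_bump: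
  assumes "c \<in> A" "r > 0" "cball a r \<subseteq> chart_range c"
  shows "C1_map A (chart_bump c a r)"
  unfolding C1_map_def
proof
  fix d assume d: "d \<in> A"
  let ?K = "chart_inv c ` cball a r"
  have K: "?K \<subseteq> chart_dom c"
  proof
    fix p assume "p \<in> ?K"
    then obtain x where "x \<in> chart_range c" "p = chart_inv c x" using assms(3) by blast
    then show "p \<in> chart_dom c" using chart_inv_in_dom[of x c] by simp
  qed
  have op: "openin M (topspace M - ?K)"
    using closedin_chart_inv_cball[OF assms(1,3)] by (simp add: closedin_def)
  let ?U1 = "chart_map d ` (chart_dom d \<inter> chart_dom c)"
  let ?U2 = "chart_map d ` (chart_dom d \<inter> (topspace M - ?K))"
  have "Ck_on 1 (in_chart d (chart_bump c a r)) (?U1 \<union> ?U2)"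
  proof (rule C1_on_Un)
    show "Ck_on 1 (in_chart d (chart_bump c a r)) ?U1"
    proof (rule C1_on_cong[OF open_overlap[OF d assms(1)]])
      show "Ck_on 1 (\<lambda>x. bump a r (in_chart d (chart_map c) x)) ?U1"
        by (rule C1_on_compose[OF open_overlap[OF d assms(1)] C1_on_transition[OF d assms(1)] C1_on_bump]) simp
    qed (use d in \<open>auto simp: chart_bump_def\<close>)
    show "Ck_on 1 (in_chart d (chart_bump c a r)) ?U2"
      by (rule C1_on_cong[OF open_chart_image[OF d op] C1_on_const[of _ 0]])
        (use d open_chart_image[OF d op] chart_bump_eq_0[OF assms] in auto)
  qed (use d open_chart_image[OF d op] open_overlap[OF d assms(1)] in auto)
  moreover have "?U1 \<union> ?U2 = chart_range d"
    using K chart_dom_subset[OF d] by blast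
  ultimately show "Ck_on 1 (in_chart d (chart_bump c a r)) (chart_range d)"
    by (simp only:)
qed

end

section \<open>Second-order conditions at a maximum\<close>

lemma second_derivative_nonpos_at_local_max:
  fixes g g' :: "real \<Rightarrow> real"
  assumes "d > 0"
    and g: "\<And>s. \<bar>s\<bar> < d \<Longrightarrow> (g has_real_derivative g' s) (at s)"
    and g': "(g' has_real_derivative g2) (at 0)"
    and max: "\<And>s. \<bar>s\<bar> < d \<Longrightarrow> g s \<le> g 0"
  shows "g' 0 = 0" "g2 \<le> 0"
proof -
  show 0: "g' 0 = 0"
    by (rule DERIV_local_max[OF g[of 0] assms(1)]) (use assms(1) max in auto)
  show "g2 \<le> 0"
  proof (rule ccontr)
    assume "\<not> g2 \<le> 0"
    then obtain e where e: "e > 0" "\<And>h. 0 < h \<Longrightarrow> h < e \<Longrightarrow> g' 0 < g' (0 + h)"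
      using DERIV_pos_inc_right[OF g'] by auto
    define h where "h = min d e / 2"
    have h: "0 < h" "h < d" "h < e"
      using assms(1) e(1) by (auto simp: h_def)
    have "\<exists>z>0. z < h \<and> g h - g 0 = (h - 0) * g' z"
      by (rule MVT2[OF h(1)]) (use h(2) g in auto)
    then obtain z where z: "0 < z" "z < h" "g h - g 0 = h * g' z" by auto
    have "g' z > 0" using e(2)[of z] z h 0 by simp
    then have "g h - g 0 > 0" using z(3) h(1) by simp
    then show False using max[of h] h by simp
  qed
qed

section \<open>Curvature of an immersed oriented surface\<close>

text \<open>By Lagrange's identity the product with n vanishes, and multiplying by n once more recovers the
  normal component.\<close>

lemma cross3_normal_eq_multiple:
  assumes "norm n = 1" "n \<bullet> a = 0" "n \<bullet> b = 0"
  shows "cross3 a b = (n \<bullet> cross3 a b) *\<^sub>R n"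
proof -
  have "cross3 n (cross3 a b) = 0"
    using assms by (simp add: Lagrange)
  then have "cross3 n (cross3 n (cross3 a b)) = 0" by simp
  then show ?thesis
    using assms Lagrange[of n n "cross3 a b"] by (simp add: norm_eq_1)
qed

text \<open>If the product vanished, then by Lagrange's identity P would annihilate the vector below, whose
  second coordinate is minus the squared norm of the first column of P.\<close>

lemma cross3_inj_nonzero:
  fixes P :: "real^2 \<Rightarrow> real^3"
  assumes "linear P" "inj P"
  shows "cross3 (P (axis 1 1)) (P (axis 2 1)) \<noteq> 0"
proof
  let ?e = "axis 1 1 :: real^2" let ?e' = "axis 2 1 :: real^2"
  let ?y = "(P ?e \<bullet> P ?e') *\<^sub>R ?e - (P ?e \<bullet> P ?e) *\<^sub>R ?e'"
  assume "cross3 (P ?e) (P ?e') = 0"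
  then have "cross3 (P ?e) (cross3 (P ?e) (P ?e')) = 0" by simp
  then have "P ?y = 0"
    by (simp add: Lagrange linear_diff[OF assms(1)] linear_cmul[OF assms(1)])
  then have "?y = 0" using assms by (metis linear_injective_0)
  then have "?y $ 2 = 0" by simp
  then have "P ?e = 0" by (simp add: axis_def)
  then have "?e = 0" using assms by (metis linear_injective_0)
  then show False by simp
qed

locale immersed_surface = surface M A for M :: "'a topology" and A :: "'a chart set" +
  fixes \<psi> N :: "'a \<Rightarrow> real^3"
  assumes immersion: "immersion A \<psi>" and gauss_map: "gauss_map M A \<psi> N"
begin

lemma smooth_immersion: "smooth_map A \<psi>"
  using immersion by (simp add: immersion_def)

lemma smooth_normal: "smooth_map A N"
  using gauss_map by (simp add: gauss_map_def)

lemmas C1_map_immersion = smooth_map_imp_C1_map[OF smooth_immersion]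
lemmas C1_map_normal = smooth_map_imp_C1_map[OF smooth_normal]
lemmas C2_on_immersion = smooth_map_imp_C2_on[OF smooth_immersion]

lemma inj_chart_deriv: "c \<in> A \<Longrightarrow> p \<in> chart_dom c \<Longrightarrow> inj (chart_deriv c \<psi> p)"
  using immersion by (simp add: immersion_def)

lemma norm_normal: "p \<in> topspace M \<Longrightarrow> norm (N p) = 1"
  using gauss_map by (simp add: gauss_map_def)

lemma in_tangent_plane: "c \<in> A \<Longrightarrow> p \<in> chart_dom c \<Longrightarrow> chart_deriv c \<psi> p u \<in> tangent_plane A \<psi> p"
  unfolding tangent_plane_def by blast

lemma normal_orthogonal: "c \<in> A \<Longrightarrow> p \<in> chart_dom c \<Longrightarrow> N p \<bullet> chart_deriv c \<psi> p u = 0"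
  using gauss_map in_tangent_plane[of c p u] chart_dom_subset[of c]
  by (auto simp: gauss_map_def)

text \<open>Differentiate \<open>\<langle>N, N\<rangle> = 1\<close>.\<close>

lemma normal_deriv_orthogonal:
  assumes "c \<in> A" "p \<in> chart_dom c"
  shows "N p \<bullet> chart_deriv c N p u = 0"
proof -
  let ?x = "chart_map c p" let ?N = "in_chart c N"
  have "((\<lambda>x. ?N x \<bullet> ?N x) has_derivative
      (\<lambda>h. ?N ?x \<bullet> chart_deriv c N p h + chart_deriv c N p h \<bullet> ?N ?x)) (at ?x)"
    by (intro has_derivative_inner chart_deriv_works[OF C1_map_normal assms])
  moreover have "((\<lambda>x. ?N x \<bullet> ?N x) has_derivative (\<lambda>h. 0)) (at ?x)"
  proof (rule has_derivative_transform_within_open[OF has_derivative_const open_chart_range[OF assms(1)]])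
    show "?x \<in> chart_range c" using assms(2) by blast
    show "1 = ?N x \<bullet> ?N x" if "x \<in> chart_range c" for x
      using norm_normal[of "chart_inv c x"] chart_inv_in_dom[OF that] chart_dom_subset[OF assms(1)]
      by (auto simp: in_chart_eq norm_eq_1)
  qed
  ultimately have "(\<lambda>h. ?N ?x \<bullet> chart_deriv c N p h + chart_deriv c N p h \<bullet> ?N ?x) = (\<lambda>h. 0)"
    by (rule has_derivative_unique)
  from fun_cong[OF this, of u] show ?thesis
    using assms by (simp add: inner_commute)
qed

definition chart_deriv2 :: "'a chart \<Rightarrow> 'a \<Rightarrow> real^2 \<Rightarrow> real^2 \<Rightarrow> real^3" where
  "chart_deriv2 c p w u =
    frechet_derivative (\<lambda>x. frechet_derivative (in_chart c \<psi>) (at x) w) (at (chart_map c p)) u"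

lemma chart_deriv2_works:
  assumes "c \<in> A" "p \<in> chart_dom c"
  shows "((\<lambda>x. frechet_derivative (in_chart c \<psi>) (at x) w) has_derivative chart_deriv2 c p w)
    (at (chart_map c p))"
  unfolding chart_deriv2_def
  using C1_on_has_derivative[OF C2_on_derivative_C1_on[OF C2_on_immersion[OF assms(1)]], of "chart_map c p" w]
    assms(2) by (simp add: image_eqI)

text \<open>Differentiate \<open>\<langle>N, d\<psi>(w)\<rangle> = 0\<close>.\<close>

lemma normal_deriv_second_fundamental_form:
  assumes "c \<in> A" "p \<in> chart_dom c"
  shows "chart_deriv c N p u \<bullet> chart_deriv c \<psi> p w = - (N p \<bullet> chart_deriv2 c p w u)"
proof -
  let ?x = "chart_map c p" let ?N = "in_chart c N"
  let ?D = "\<lambda>x. frechet_derivative (in_chart c \<psi>) (at x) w"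
  have "((\<lambda>x. ?N x \<bullet> ?D x) has_derivative
      (\<lambda>h. ?N ?x \<bullet> chart_deriv2 c p w h + chart_deriv c N p h \<bullet> ?D ?x)) (at ?x)"
    by (intro has_derivative_inner chart_deriv_works[OF C1_map_normal assms] chart_deriv2_works[OF assms])
  moreover have "((\<lambda>x. ?N x \<bullet> ?D x) has_derivative (\<lambda>h. 0)) (at ?x)"
  proof (rule has_derivative_transform_within_open[OF has_derivative_const open_chart_range[OF assms(1)]])
    show "?x \<in> chart_range c" using assms(2) by blast
    show "0 = ?N x \<bullet> ?D x" if "x \<in> chart_range c" for x
      using normal_orthogonal[OF assms(1) chart_inv_in_dom[OF that], of w]
      by (simp add: in_chart_eq[of _ N] chart_deriv_def chart_chart_inv[OF that])
  qed
  ultimately have "(\<lambda>h. ?N ?x \<bullet> chart_deriv2 c p w h + chart_deriv c N p h \<bullet> ?D ?x) = (\<lambda>h. 0)"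
    by (rule has_derivative_unique)
  from fun_cong[OF this, of u] show ?thesis
    using assms by (simp add: chart_deriv_def)
qed

lemma second_fundamental_form_symmetric:
  assumes "c \<in> A" "p \<in> chart_dom c"
  shows "chart_deriv c N p u \<bullet> chart_deriv c \<psi> p w = chart_deriv c N p w \<bullet> chart_deriv c \<psi> p u"
proof -
  have "chart_deriv2 c p w u = chart_deriv2 c p u w"
    unfolding chart_deriv2_def
    by (rule C2_on_symmetric_derivatives[OF open_chart_range C2_on_immersion]) (use assms in auto)
  then show ?thesis by (simp add: normal_deriv_second_fundamental_form[OF assms])
qed

text \<open>Under a change of charts the differentials of \<open>\<psi>\<close> and N are composed with the same linear map, and
  that of \<open>\<psi>\<close> is injective; so the definite description does not depend on the chart.\<close>

lemma shape_operator_chart: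
  assumes "c \<in> A" "p \<in> chart_dom c"
  shows "shape_operator A \<psi> N p (chart_deriv c \<psi> p u) = - chart_deriv c N p u"
  unfolding shape_operator_def
proof (rule the_equality)
  show "\<exists>c'\<in>A. \<exists>u'. p \<in> chart_dom c' \<and> chart_deriv c \<psi> p u = chart_deriv c' \<psi> p u' \<and>
      - chart_deriv c N p u = - chart_deriv c' N p u'"
    using assms by (intro bexI[of _ c] exI[of _ u]) simp_all
next
  fix z
  assume "\<exists>c'\<in>A. \<exists>u'. p \<in> chart_dom c' \<and> chart_deriv c \<psi> p u = chart_deriv c' \<psi> p u' \<and>
      z = - chart_deriv c' N p u'"
  then obtain d u' where d: "d \<in> A" "p \<in> chart_dom d"
    "chart_deriv c \<psi> p u = chart_deriv d \<psi> p u'" "z = - chart_deriv d N p u'" by blast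
  have "chart_deriv d \<psi> p u' = chart_deriv d \<psi> p (chart_deriv c (chart_map d) p u)"
    using chart_deriv_transition[OF C1_map_immersion assms(1) d(1) assms(2) d(2)] d(3) by metis
  then have "u' = chart_deriv c (chart_map d) p u"
    using inj_chart_deriv[OF d(1,2)] by (simp add: inj_eq)
  then show "z = - chart_deriv c N p u"
    using chart_deriv_transition[OF C1_map_normal assms(1) d(1) assms(2) d(2)] d(4) by simp
qed

lemma principal_curvatures_chart_iff:
  assumes "c \<in> A" "p \<in> chart_dom c"
  shows "principal_curvatures A \<psi> N p k1 k2 \<longleftrightarrow>
    (\<exists>u1 u2. norm (chart_deriv c \<psi> p u1) = 1 \<and> norm (chart_deriv c \<psi> p u2) = 1 \<and>
      chart_deriv c \<psi> p u1 \<bullet> chart_deriv c \<psi> p u2 = 0 \<and>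
      chart_deriv c N p u1 = - k1 *\<^sub>R chart_deriv c \<psi> p u1 \<and>
      chart_deriv c N p u2 = - k2 *\<^sub>R chart_deriv c \<psi> p u2)"
proof -
  have tp: "tangent_plane A \<psi> p = range (chart_deriv c \<psi> p)"
  proof
    show "tangent_plane A \<psi> p \<subseteq> range (chart_deriv c \<psi> p)"
    proof
      fix e assume "e \<in> tangent_plane A \<psi> p"
      then obtain d u where d: "d \<in> A" "p \<in> chart_dom d" "e = chart_deriv d \<psi> p u"
        by (auto simp: tangent_plane_def)
      then show "e \<in> range (chart_deriv c \<psi> p)"
        using chart_deriv_transition[OF C1_map_immersion d(1) assms(1) d(2) assms(2)] by auto
    qed
    show "range (chart_deriv c \<psi> p) \<subseteq> tangent_plane A \<psi> p"
      using in_tangent_plane[OF assms] by blast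
  qed
  have "- x = k *\<^sub>R y \<longleftrightarrow> x = - k *\<^sub>R y" for x y :: "real^3" and k
    by (metis minus_minus scaleR_minus_left)
  then show ?thesis
    unfolding principal_curvatures_def tp
    by (simp add: shape_operator_chart[OF assms])
qed

text \<open>The sum of the principal curvatures is determined by the wedge product of the differentials of N and
  \<open>\<psi>\<close>, hence is the same for all choices of principal directions.\<close>

lemma principal_directions_chart:
  assumes "c \<in> A" "p \<in> chart_dom c"
  obtains u1 u2 k1 k2 where
    "norm (chart_deriv c \<psi> p u1) = 1" "norm (chart_deriv c \<psi> p u2) = 1"
    "chart_deriv c \<psi> p u1 \<bullet> chart_deriv c \<psi> p u2 = 0"
    "chart_deriv c N p u1 = - k1 *\<^sub>R chart_deriv c \<psi> p u1"
    "chart_deriv c N p u2 = - k2 *\<^sub>R chart_deriv c \<psi> p u2"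
    "mean_curvature A \<psi> N p = (k1 + k2) / 2"
proof -
  let ?P = "chart_deriv c \<psi> p" let ?Q = "chart_deriv c N p"
  note lin = linear_chart_deriv[OF C1_map_immersion assms] linear_chart_deriv[OF C1_map_normal assms]
  have p: "p \<in> topspace M" using chart_dom_subset[OF assms(1)] assms(2) by blast
  obtain u1 u2 k1 k2 where U: "norm (?P u1) = 1" "norm (?P u2) = 1" "?P u1 \<bullet> ?P u2 = 0"
    "?Q u1 = - k1 *\<^sub>R ?P u1" "?Q u2 = - k2 *\<^sub>R ?P u2"
    using exists_principal_directions[OF lin(1) inj_chart_deriv[OF assms] lin(2) norm_normal[OF p]
        normal_orthogonal[OF assms] normal_deriv_orthogonal[OF assms]
        second_fundamental_form_symmetric[OF assms]] .
  have "mean_curvature A \<psi> N p = (k1 + k2) / 2"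
    unfolding mean_curvature_def
  proof (rule the_equality)
    show "\<exists>k1' k2'. principal_curvatures A \<psi> N p k1' k2' \<and> (k1 + k2) / 2 = (k1' + k2') / 2"
      using U principal_curvatures_chart_iff[OF assms] by blast
  next
    fix h assume "\<exists>k1' k2'. principal_curvatures A \<psi> N p k1' k2' \<and> h = (k1' + k2') / 2"
    then obtain k1' k2' u1' u2' where U': "norm (?P u1') = 1" "norm (?P u2') = 1" "?P u1' \<bullet> ?P u2' = 0"
        "?Q u1' = - k1' *\<^sub>R ?P u1'" "?Q u2' = - k2' *\<^sub>R ?P u2'" "h = (k1' + k2') / 2"
      using principal_curvatures_chart_iff[OF assms] by blast
    have "- (k1 + k2) *\<^sub>R cross3 (?P u1) (?P u2) = - (k1' + k2') *\<^sub>R cross3 (?P u1) (?P u2)"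
      using wedge_eq_trace_principal[OF lin U, of u1 u2] wedge_eq_trace_principal[OF lin U'(1-5), of u1 u2]
      by (simp only:)
    then have "- (k1 + k2) = - (k1' + k2')"
      using cross3_orthonormal_nonzero[OF U(1-3)] by (simp only: real_vector.scale_cancel_right) blast
    then show "h = (k1 + k2) / 2" using U'(6) by simp
  qed
  with U that show ?thesis by blast
qed

lemma wedge_eq_mean_curvature:
  assumes "c \<in> A" "p \<in> chart_dom c"
  shows "cross3 (chart_deriv c N p u) (chart_deriv c \<psi> p w) - cross3 (chart_deriv c N p w) (chart_deriv c \<psi> p u)
    = (- 2 * mean_curvature A \<psi> N p) *\<^sub>R cross3 (chart_deriv c \<psi> p u) (chart_deriv c \<psi> p w)"
proof -
  note lin = linear_chart_deriv[OF C1_map_immersion assms] linear_chart_deriv[OF C1_map_normal assms]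
  obtain u1 u2 k1 k2 where U: "norm (chart_deriv c \<psi> p u1) = 1" "norm (chart_deriv c \<psi> p u2) = 1"
    "chart_deriv c \<psi> p u1 \<bullet> chart_deriv c \<psi> p u2 = 0"
    "chart_deriv c N p u1 = - k1 *\<^sub>R chart_deriv c \<psi> p u1"
    "chart_deriv c N p u2 = - k2 *\<^sub>R chart_deriv c \<psi> p u2"
    and H: "mean_curvature A \<psi> N p = (k1 + k2) / 2"
    by (rule principal_directions_chart[OF assms])
  have "- (k1 + k2) = - 2 * mean_curvature A \<psi> N p" using H by simp
  then show ?thesis using wedge_eq_trace_principal[OF lin U, of u w] by (simp only:)
qed

text \<open>The gradient \<open>t \<psi> + w\<close> is normal at the maximum, so it is \<open>\<kappa> N\<close>.  The second derivative of the function
  in a principal direction is then \<open>t + \<kappa> k\<close> with k the principal curvature, and it cannot be positive.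
  The value t = 0 compares the surface with a plane, t = 1 with a sphere.\<close>

lemma mean_curvature_at_maximum:
  assumes p: "p \<in> topspace M"
    and max: "\<And>q. q \<in> topspace M \<Longrightarrow>
      t / 2 * (\<psi> q \<bullet> \<psi> q) + \<psi> q \<bullet> w \<le> t / 2 * (\<psi> p \<bullet> \<psi> p) + \<psi> p \<bullet> w"
  obtains \<kappa> where "t *\<^sub>R \<psi> p + w = \<kappa> *\<^sub>R N p" "t + \<kappa> * mean_curvature A \<psi> N p \<le> 0"
proof -
  obtain c where c: "c \<in> A" "p \<in> chart_dom c" using p topspace_eq by auto
  let ?x = "chart_map c p" let ?\<psi> = "in_chart c \<psi>" let ?P = "chart_deriv c \<psi> p"
  let ?z = "t *\<^sub>R \<psi> p + w"
  have x: "?x \<in> chart_range c" using c by blast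
  obtain d where d: "d > 0" "ball ?x d \<subseteq> chart_range c"
    using open_chart_range[OF c(1)] x open_contains_ball by blast
  have *: "?z \<bullet> ?P u = 0" "t * (?P u \<bullet> ?P u) + ?z \<bullet> chart_deriv2 c p u u \<le> 0" for u
  proof -
    let ?l = "\<lambda>s. ?x + s *\<^sub>R u"
    let ?D = "\<lambda>x. frechet_derivative ?\<psi> (at x) u"
    define g where "g = (\<lambda>s. t / 2 * (?\<psi> (?l s) \<bullet> ?\<psi> (?l s)) + ?\<psi> (?l s) \<bullet> w)"
    define g' where "g' = (\<lambda>s. (t *\<^sub>R ?\<psi> (?l s) + w) \<bullet> ?D (?l s))"
    have pos: "norm u + 1 > 0" by (smt (verit) norm_ge_zero)
    define r where "r = d / (norm u + 1)"
    have r: "r > 0" using d(1) pos by (simp add: r_def)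
    have inV: "?l s \<in> chart_range c" if "\<bar>s\<bar> < r" for s
    proof -
      have "\<bar>s\<bar> * norm u \<le> \<bar>s\<bar> * (norm u + 1)" by (simp add: algebra_simps)
      also have "\<dots> < d" using that pos by (simp add: r_def pos_less_divide_eq)
      finally have "?l s \<in> ball ?x d" by (simp add: dist_norm)
      then show ?thesis using d(2) by blast
    qed
    have D1: "((\<lambda>s. ?\<psi> (?l s)) has_vector_derivative ?D (?l s)) (at s)" if "\<bar>s\<bar> < r" for s
      by (rule has_vector_derivative_along_line)
        (rule C1_on_has_derivative[OF C1_map_imp_C1_on[OF C1_map_immersion c(1)] inV[OF that]])
    have D1_0: "((\<lambda>s. ?\<psi> (?l s)) has_vector_derivative ?D (?l 0)) (at 0)"
      by (rule D1) (use r in simp)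
    have D2: "((\<lambda>s. ?D (?l s)) has_vector_derivative chart_deriv2 c p u u) (at 0)"
      by (rule has_vector_derivative_along_line) (use chart_deriv2_works[OF c] in simp)
    have "(g has_real_derivative g' s) (at s)" if "\<bar>s\<bar> < r" for s
    proof -
      have "(g has_vector_derivative t / 2 * (?\<psi> (?l s) \<bullet> ?D (?l s) + ?D (?l s) \<bullet> ?\<psi> (?l s))
          + ?D (?l s) \<bullet> w) (at s)"
        unfolding g_def has_vector_derivative_def
        by (rule derivative_eq_intros D1[OF that, unfolded has_vector_derivative_def] refl)+
          (simp add: fun_eq_iff algebra_simps)
      moreover have "t / 2 * (?\<psi> (?l s) \<bullet> ?D (?l s) + ?D (?l s) \<bullet> ?\<psi> (?l s)) + ?D (?l s) \<bullet> w = g' s"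
        by (simp add: g'_def inner_add_left inner_add_right inner_commute)
      ultimately show ?thesis by (simp only: has_real_derivative_iff_has_vector_derivative)
    qed
    moreover have "(g' has_real_derivative t * (?P u \<bullet> ?P u) + ?z \<bullet> chart_deriv2 c p u u) (at 0)"
    proof -
      have "(g' has_vector_derivative (t *\<^sub>R ?D (?l 0)) \<bullet> ?D (?l 0) +
          (t *\<^sub>R ?\<psi> (?l 0) + w) \<bullet> chart_deriv2 c p u u) (at 0)"
        unfolding g'_def has_vector_derivative_def
        by (rule derivative_eq_intros D1_0[unfolded has_vector_derivative_def]
            D2[unfolded has_vector_derivative_def] refl)+ (simp add: fun_eq_iff algebra_simps)
      then show ?thesis
        using c by (simp add: has_real_derivative_iff_has_vector_derivative chart_deriv_def)
    qed
    moreover have "g s \<le> g 0" if "\<bar>s\<bar> < r" for s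
    proof -
      have "chart_inv c (?l s) \<in> topspace M"
        using chart_inv_in_dom[OF inV[OF that]] chart_dom_subset[OF c(1)] by blast
      from max[OF this] show ?thesis
        using c by (simp add: g_def in_chart_eq)
    qed
    ultimately have "g' 0 = 0" "t * (?P u \<bullet> ?P u) + ?z \<bullet> chart_deriv2 c p u u \<le> 0"
      using second_derivative_nonpos_at_local_max[OF r, of g g'] by blast+
    then show "?z \<bullet> ?P u = 0" "t * (?P u \<bullet> ?P u) + ?z \<bullet> chart_deriv2 c p u u \<le> 0"
      using c by (simp_all add: g'_def chart_deriv_def)
  qed
  obtain u1 u2 k1 k2 where U: "norm (?P u1) = 1" "norm (?P u2) = 1" "?P u1 \<bullet> ?P u2 = 0"
    "chart_deriv c N p u1 = - k1 *\<^sub>R ?P u1" "chart_deriv c N p u2 = - k2 *\<^sub>R ?P u2"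
    and H: "mean_curvature A \<psi> N p = (k1 + k2) / 2"
    by (rule principal_directions_chart[OF c])
  have z: "?z = (?z \<bullet> N p) *\<^sub>R N p"
    by (rule orthogonal_plane_eq_multiple[OF norm_normal[OF p] U(1,2) _ _ U(3)])
      (simp_all add: normal_orthogonal[OF c] *(1))
  have bound: "t + (?z \<bullet> N p) * k \<le> 0"
    if "norm (?P u) = 1" "chart_deriv c N p u = - k *\<^sub>R ?P u" for u k
  proof -
    have "N p \<bullet> chart_deriv2 c p u u = k"
      using normal_deriv_second_fundamental_form[OF c, of u u] that by (simp add: norm_eq_1)
    then have "?z \<bullet> chart_deriv2 c p u u = (?z \<bullet> N p) * k"
      by (subst z) simp
    then show ?thesis using *(2)[of u] that(1) by (simp add: norm_eq_1)
  qed
  have "t + (?z \<bullet> N p) * mean_curvature A \<psi> N p \<le> 0"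
  proof -
    have "t + K * ((k1 + k2) / 2) \<le> 0" if "t + K * k1 \<le> 0" "t + K * k2 \<le> 0" for K
    proof -
      have "t + K * ((k1 + k2) / 2) = ((t + K * k1) + (t + K * k2)) / 2"
        by (simp add: field_simps)
      also have "\<dots> \<le> 0" by (intro divide_nonpos_pos add_nonpos_nonpos that) simp
      finally show ?thesis .
    qed
    from this[OF bound[OF U(1,4)] bound[OF U(2,5)]] show ?thesis
      unfolding H .
  qed
  with z that show ?thesis by blast
qed

end

section \<open>Integration over a closed surface\<close>

lemma integral_eq_on_support:
  fixes f :: "'a::euclidean_space \<Rightarrow> real"
  assumes "S \<subseteq> V" "\<And>x. x \<in> V - S \<Longrightarrow> f x = 0"
  shows "integral V f = integral S f"
proof -
  have "(\<lambda>x. if x \<in> V then f x else 0) = (\<lambda>x. if x \<in> S then f x else 0)"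
    using assms by (auto simp: fun_eq_iff)
  then have "integral UNIV (\<lambda>x. if x \<in> V then f x else 0) = integral UNIV (\<lambda>x. if x \<in> S then f x else 0)"
    by (simp only:)
  then show ?thesis by (simp only: integral_restrict_UNIV)
qed

lemma absolutely_integrable_support_in_open:
  fixes f :: "'a::euclidean_space \<Rightarrow> real"
  assumes "open V" "compact K" "K \<subseteq> V" "continuous_on V f" "\<And>x. x \<in> V - K \<Longrightarrow> f x = 0"
  shows "f absolutely_integrable_on V"
proof -
  have "(\<lambda>x. if x \<in> V then f x else 0) absolutely_integrable_on UNIV"
    by (rule absolutely_integrable_compact_support[OF
          continuous_on_extend_zero[OF assms(1) compact_imp_closed[OF assms(2)] assms(3-5)]
          compact_imp_bounded[OF assms(2)]]) (use assms(5) in auto)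
  then show ?thesis by (simp only: absolutely_integrable_restrict_UNIV)
qed

text \<open>The extension by zero is continuous on a box, where the statement is a known property of the integral.\<close>

lemma nonneg_integral_eq_0_imp_eq_0:
  fixes f :: "'a::euclidean_space \<Rightarrow> real"
  assumes "open V" "compact K" "K \<subseteq> V" "continuous_on V f" "\<And>x. x \<in> V - K \<Longrightarrow> f x = 0"
    and "\<And>x. x \<in> V \<Longrightarrow> f x \<ge> 0" "integral V f = 0" "x \<in> V"
  shows "f x = 0"
proof -
  let ?f = "\<lambda>x. if x \<in> V then f x else 0"
  have "bounded (insert x K)" using compact_imp_bounded[OF assms(2)] by simp
  then obtain c where c: "insert x K \<subseteq> box (-c) c"
    using bounded_subset_box_symmetric by blast
  then have K: "insert x K \<subseteq> cbox (-c) c" using box_subset_cbox[of "-c" c] by (rule order_trans)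
  have cont: "continuous_on UNIV ?f"
    by (rule continuous_on_extend_zero[OF assms(1) compact_imp_closed[OF assms(2)] assms(3-5)])
  have "integral UNIV ?f = integral (cbox (-c) c) ?f"
    by (rule integral_eq_on_support) (use K assms(5) in auto)
  then have "integral (cbox (-c) c) ?f = 0"
    using assms(7) by (simp only: integral_restrict_UNIV)
  moreover have contc: "continuous_on (cbox (-c) c) ?f"
    by (rule continuous_on_subset[OF cont subset_UNIV])
  ultimately have "(?f has_integral 0) (cbox (-c) c)"
    using integrable_integral[OF integrable_continuous[OF contc]] by simp
  moreover have "box (-c) c \<noteq> {}" "x \<in> cbox (-c) c" using c K by auto
  ultimately have "?f x = 0"
    using has_integral_0_cbox_imp_0[OF contc, of x] assms(6) by simp
  then show ?thesis using assms(8) by simp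
qed

lemma integral_change_of_variables_real_valued:
  fixes f :: "real^'m::{finite,wellorder} \<Rightarrow> real" and g :: "real^'m::_ \<Rightarrow> real^'m::_"
  assumes "S \<in> sets lebesgue"
    and "\<And>x. x \<in> S \<Longrightarrow> (g has_derivative g' x) (at x within S)"
    and "inj_on g S" and f: "f absolutely_integrable_on g ` S"
  shows "integral S (\<lambda>x. \<bar>det (matrix (g' x))\<bar> * f (g x)) = integral (g ` S) f"
proof -
  let ?f = "\<lambda>x. vec (f x) :: real^1"
  have "?f absolutely_integrable_on g ` S"
    using f by (simp add: absolutely_integrable_on_1_iff)
  then have "integral S (\<lambda>x. \<bar>det (matrix (g' x))\<bar> *\<^sub>R ?f (g x)) = integral (g ` S) ?f"
    using has_absolute_integral_change_of_variables[OF assms(1-3), of ?f "integral (g ` S) ?f"] by blast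
  then have "(vec (integral S (\<lambda>x. \<bar>det (matrix (g' x))\<bar> * f (g x))) :: real^1) = vec (integral (g ` S) f)"
    by (simp add: integral_on_1_eq)
  then show ?thesis by (simp add: vec_eq_iff)
qed

context surface
begin

lemma C1_map_const: "C1_map A (\<lambda>p. c)"
  unfolding C1_map_def in_chart_def o_def
  by (rule ballI, rule C1_on_const) (simp add: open_chart_range)

lemma chart_deriv_const: "chart_deriv c (\<lambda>p. k) p u = 0"
  by (simp add: chart_deriv_def in_chart_def o_def)

lemma chart_deriv_eq_0:
  assumes "c \<in> A" "p \<in> chart_dom c" "closedin M K" "p \<notin> K"
    and "\<And>q. q \<in> topspace M - K \<Longrightarrow> f q = 0"
  shows "chart_deriv c f p u = 0"
proof -
  have "chart_deriv c f p = chart_deriv c (\<lambda>p. 0) p"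
  proof (rule chart_deriv_cong[OF assms(1,2) _ _ assms(5) C1_map_const])
    show "openin M (topspace M - K)" using assms(3) by (simp add: closedin_def)
    show "p \<in> topspace M - K" using assms(1,2,4) chart_dom_subset[of c] by blast
  qed
  then show ?thesis by (simp add: chart_deriv_const)
qed

lemma chart_deriv_sum:
  assumes "c \<in> A" "p \<in> chart_dom c" "finite I" "\<And>i. i \<in> I \<Longrightarrow> C1_map A (f i)"
  shows "chart_deriv c (\<lambda>p. \<Sum>i\<in>I. f i p) p u = (\<Sum>i\<in>I. chart_deriv c (f i) p u)"
proof -
  have "((\<lambda>x. \<Sum>i\<in>I. in_chart c (f i) x) has_derivative (\<lambda>h. \<Sum>i\<in>I. chart_deriv c (f i) p h))
      (at (chart_map c p))"
    by (intro has_derivative_sum chart_deriv_works assms)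
  then have "(in_chart c (\<lambda>p. \<Sum>i\<in>I. f i p) has_derivative (\<lambda>h. \<Sum>i\<in>I. chart_deriv c (f i) p h))
      (at (chart_map c p))"
    by (simp add: in_chart_def o_def)
  from chart_deriv_eqI[OF this] show ?thesis by simp
qed

text \<open>On a compact surface finitely many chart balls cover; normalising the sum of their bump
  functions gives a partition of unity of class C^1.\<close>

lemma finite_partition_of_unity:
  assumes "compact_space M"
  obtains I :: "('a chart \<times> (real^2) \<times> real) set" and C a r \<rho> where
    "finite I" "\<And>i. i \<in> I \<Longrightarrow> C i \<in> A" "\<And>i. i \<in> I \<Longrightarrow> cball (a i) (r i) \<subseteq> chart_range (C i)"
    "\<And>i. i \<in> I \<Longrightarrow> C1_map A (\<rho> i)" "\<And>i p. i \<in> I \<Longrightarrow> \<rho> i p \<ge> (0::real)"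
    "\<And>i p. i \<in> I \<Longrightarrow> p \<notin> chart_inv (C i) ` cball (a i) (r i) \<Longrightarrow> \<rho> i p = 0"
    "\<And>p. p \<in> topspace M \<Longrightarrow> (\<Sum>i\<in>I. \<rho> i p) = 1"
proof -
  define X :: "('a chart \<times> (real^2) \<times> real) set" where
    "X = {i. fst i \<in> A \<and> 0 < snd (snd i) \<and> cball (fst (snd i)) (snd (snd i)) \<subseteq> chart_range (fst i)}"
  define C where "C = (fst :: 'a chart \<times> (real^2) \<times> real \<Rightarrow> 'a chart)"
  define a where "a = (\<lambda>i :: 'a chart \<times> (real^2) \<times> real. fst (snd i))"
  define r where "r = (\<lambda>i :: 'a chart \<times> (real^2) \<times> real. snd (snd i))"
  have X: "C i \<in> A" "0 < r i" "cball (a i) (r i) \<subseteq> chart_range (C i)" if "i \<in> X" for i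
    using that by (auto simp: X_def C_def a_def r_def)
  define F where "F = (\<lambda>i. chart_inv (C i) ` ball (a i) (r i))"
  have ball: "ball (a i) (r i) \<subseteq> chart_range (C i)" if "i \<in> X" for i
    by (rule order_trans[OF ball_subset_cball X(3)[OF that]])
  have op: "openin M (F i)" if "i \<in> X" for i
    unfolding F_def by (rule openin_chart_inv_image[OF X(1)[OF that] open_ball ball[OF that]])
  have "\<Union>(F ` X) = topspace M"
  proof
    show "\<Union>(F ` X) \<subseteq> topspace M"
      by (rule UN_least) (rule openin_subset[OF op])
    show "topspace M \<subseteq> \<Union>(F ` X)"
    proof
      fix p assume "p \<in> topspace M"
      then obtain c where c: "c \<in> A" "p \<in> chart_dom c" using topspace_eq by blast
      then have "chart_map c p \<in> chart_range c" by blast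
      then obtain e where e: "e > 0" "cball (chart_map c p) e \<subseteq> chart_range c"
        using open_chart_range[OF c(1)] open_contains_cball by blast
      let ?i = "(c, chart_map c p, e)"
      have "?i \<in> X" using c e by (simp add: X_def)
      moreover have "p \<in> F ?i"
        unfolding F_def C_def a_def r_def
        using c e by (intro image_eqI[where x = "chart_map c p"]) simp_all
      ultimately show "p \<in> \<Union>(F ` X)" by blast
    qed
  qed
  moreover have "\<forall>U\<in>F ` X. openin M U" using op by simp
  ultimately have "\<exists>\<F>. finite \<F> \<and> \<F> \<subseteq> F ` X \<and> \<Union>\<F> = topspace M"
    using assms[unfolded compact_space, rule_format, of "F ` X"] by simp
  then obtain \<F> where "finite \<F> \<and> \<F> \<subseteq> F ` X \<and> \<Union>\<F> = topspace M" ..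
  then have \<F>: "finite \<F>" "\<F> \<subseteq> F ` X" "\<Union>\<F> = topspace M" by simp_all
  obtain I where "I \<subseteq> X \<and> finite I \<and> \<F> = F ` I"
    using finite_subset_image[OF \<F>(1,2)] ..
  then have I: "I \<subseteq> X" "finite I" "\<F> = F ` I" by simp_all
  define \<beta> where "\<beta> = (\<lambda>i. chart_bump (C i) (a i) (r i))"
  define \<sigma> where "\<sigma> = (\<lambda>p. \<Sum>i\<in>I. \<beta> i p)"
  have C1\<beta>: "C1_map A (\<beta> i)" if "i \<in> I" for i
    unfolding \<beta>_def by (rule C1_map_chart_bump) (use X[of i] that I(1) in auto)
  have \<beta>: "\<beta> i p \<ge> 0" for i p by (simp add: \<beta>_def chart_bump_nonneg)
  have \<sigma>: "\<sigma> p > 0" if "p \<in> topspace M" for p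
  proof -
    have "p \<in> (\<Union>i\<in>I. F i)" using that \<F>(3) I(3) by simp
    then obtain i where i: "i \<in> I" "p \<in> F i" by (rule UN_E)
    then have "\<beta> i p > 0"
      unfolding \<beta>_def F_def using chart_bump_pos[OF X(1,2) ball] subsetD[OF I(1)] by simp
    then show ?thesis
      unfolding \<sigma>_def using i(1) I(2) \<beta> by (intro sum_pos2[of I i]) auto
  qed
  show ?thesis
  proof (rule that[of I C a r "\<lambda>i p. \<beta> i p * inverse (\<sigma> p)"])
    show "C1_map A (\<lambda>p. \<beta> i p * inverse (\<sigma> p))" if "i \<in> I" for i
    proof (rule C1_map_bounded_bilinear[OF bounded_bilinear_mult C1\<beta>[OF that] C1_map_inverse])
      show "C1_map A \<sigma>" unfolding \<sigma>_def by (rule C1_map_sum[OF I(2) C1\<beta>])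
      show "\<sigma> p \<noteq> 0" if "p \<in> topspace M" for p using \<sigma>[OF that] by simp
    qed
    show "\<beta> i p * inverse (\<sigma> p) \<ge> 0" for i p
      using \<beta> by (simp add: \<sigma>_def sum_nonneg)
    show "\<beta> i p * inverse (\<sigma> p) = 0" if "i \<in> I" "p \<notin> chart_inv (C i) ` cball (a i) (r i)" for i p
      using chart_bump_eq_0[OF X _ , of i] that(2) subsetD[OF I(1) that(1)] by (simp add: \<beta>_def)
    show "(\<Sum>i\<in>I. \<beta> i p * inverse (\<sigma> p)) = 1" if "p \<in> topspace M" for p
    proof -
      have "(\<Sum>i\<in>I. \<beta> i p * inverse (\<sigma> p)) = \<sigma> p * inverse (\<sigma> p)"
        by (simp only: sum_distrib_right \<sigma>_def)
      then show ?thesis using \<sigma>[OF that] by simp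
    qed
  qed (simp_all add: I(2) X(1,3) subsetD[OF I(1)])
qed

end

context immersed_surface
begin

text \<open>The coefficient of the area form in the coordinates of c; its sign tells whether c is compatible
  with the orientation by N.\<close>

definition area_form :: "'a chart \<Rightarrow> 'a \<Rightarrow> real" where
  "area_form c p = N p \<bullet> cross3 (chart_deriv c \<psi> p (axis 1 1)) (chart_deriv c \<psi> p (axis 2 1))"

text \<open>The coordinate expression of \<open>\<langle>dB \<and> d\<psi>\<rangle>\<close>, the exterior derivative of \<open>\<langle>B, d\<psi>\<rangle>\<close>.\<close>

definition wedge_form :: "('a \<Rightarrow> real^3) \<Rightarrow> 'a chart \<Rightarrow> 'a \<Rightarrow> real" where
  "wedge_form B c p =
    chart_deriv c B p (axis 1 1) \<bullet> chart_deriv c \<psi> p (axis 2 1) -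
    chart_deriv c B p (axis 2 1) \<bullet> chart_deriv c \<psi> p (axis 1 1)"

text \<open>Charts need not be compatible with the orientation by N, nor have connected domains.
  Multiplying by the sign of the area form turns the 2-form into a density, which transforms
  with the absolute value of the Jacobian and can be integrated in every chart.\<close>

definition wedge_density :: "('a \<Rightarrow> real^3) \<Rightarrow> 'a chart \<Rightarrow> 'a \<Rightarrow> real" where
  "wedge_density B c p = sgn (area_form c p) * wedge_form B c p"

lemma cross3_tangent_eq_area_form:
  assumes "c \<in> A" "p \<in> chart_dom c"
  shows "cross3 (chart_deriv c \<psi> p (axis 1 1)) (chart_deriv c \<psi> p (axis 2 1)) = area_form c p *\<^sub>R N p"
  unfolding area_form_def
  by (rule cross3_normal_eq_multiple)
    (use assms chart_dom_subset[of c] in \<open>auto simp: norm_normal normal_orthogonal\<close>)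

lemma area_form_nonzero:
  assumes "c \<in> A" "p \<in> chart_dom c"
  shows "area_form c p \<noteq> 0"
  using cross3_inj_nonzero[OF linear_chart_deriv[OF C1_map_immersion assms] inj_chart_deriv[OF assms]]
    cross3_tangent_eq_area_form[OF assms] by auto

lemma area_form_transition:
  assumes "c \<in> A" "d \<in> A" "p \<in> chart_dom c" "p \<in> chart_dom d"
  shows "area_form c p = det (matrix (chart_deriv c (chart_map d) p)) * area_form d p"
proof -
  let ?P = "chart_deriv d \<psi> p" let ?T = "chart_deriv c (chart_map d) p"
  let ?B = "\<lambda>u w. N p \<bullet> cross3 (?P u) (?P w)"
  note lin = linear_chart_deriv[OF C1_map_immersion assms(2,4)]
  have "bilinear (\<lambda>u w. cross3 (?P u) (?P w))"
    by (rule bilinear_comp_linear[OF bilinear_cross lin lin])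
  then have bil: "bilinear ?B"
    using linear_compose[OF _ bounded_linear.linear[OF bounded_linear_inner_right[of "N p"]]]
    by (auto simp: bilinear_def o_def)
  have anti: "?B w u = - ?B u w" for u w
    by (subst cross_skew) simp
  have "2 * ?B (?T (axis 1 1)) (?T (axis 2 1)) = 2 * (det (matrix ?T) * ?B (axis 1 1) (axis 2 1))"
    using alternating_form_R2[OF bil, of "?T (axis 1 1)" "?T (axis 2 1)"]
    unfolding det_matrix_R2 anti[of "?T (axis 2 1)"] anti[of "axis 2 1"] by simp
  then show ?thesis
    by (simp add: area_form_def chart_deriv_transition[OF C1_map_immersion assms])
qed

lemma wedge_form_transition:
  assumes "C1_map A B" "c \<in> A" "d \<in> A" "p \<in> chart_dom c" "p \<in> chart_dom d"
  shows "wedge_form B c p = det (matrix (chart_deriv c (chart_map d) p)) * wedge_form B d p"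
proof -
  have "bilinear ((\<bullet>) :: real^3 \<Rightarrow> real^3 \<Rightarrow> real)"
    by (simp add: bilinear_conv_bounded_bilinear bounded_bilinear_inner)
  then have "bilinear (\<lambda>u w. chart_deriv d B p u \<bullet> chart_deriv d \<psi> p w)"
    by (rule bilinear_comp_linear[OF _
          linear_chart_deriv[OF assms(1,3,5)] linear_chart_deriv[OF C1_map_immersion assms(3,5)]])
  from alternating_form_R2[OF this, of "chart_deriv c (chart_map d) p (axis 1 1)"
      "chart_deriv c (chart_map d) p (axis 2 1)"]
  show ?thesis
    by (simp add: wedge_form_def det_matrix_R2 chart_deriv_transition[OF C1_map_immersion assms(2-5)]
        chart_deriv_transition[OF assms])
qed

lemma wedge_density_transition:
  assumes "C1_map A B" "c \<in> A" "d \<in> A" "p \<in> chart_dom c" "p \<in> chart_dom d"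
  shows "wedge_density B c p = \<bar>det (matrix (chart_deriv c (chart_map d) p))\<bar> * wedge_density B d p"
  by (simp add: wedge_density_def area_form_transition[OF assms(2-5)] wedge_form_transition[OF assms]
      sgn_mult abs_sgn mult_ac)

lemma area_form_continuous_on:
  assumes "c \<in> A"
  shows "continuous_on (chart_range c) (\<lambda>x. area_form c (chart_inv c x))"
  unfolding area_form_def in_chart_eq[where c = c and f = N, symmetric]
  by (intro continuous_intros continuous_on_cross C1_map_continuous_on C1_map_normal
      chart_deriv_continuous_on C1_map_immersion assms)

lemma wedge_density_continuous_on:
  assumes "C1_map A B" "c \<in> A"
  shows "continuous_on (chart_range c) (\<lambda>x. wedge_density B c (chart_inv c x))"
  unfolding wedge_density_def wedge_form_def
proof (intro continuous_intros area_form_continuous_on chart_deriv_continuous_on C1_map_immersion assms ballI)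
  show "area_form c (chart_inv c x) \<noteq> 0" if "x \<in> chart_range c" for x
    by (rule area_form_nonzero[OF assms(2) chart_inv_in_dom[OF that]])
qed

lemma wedge_density_eq_0:
  assumes "c \<in> A" "p \<in> chart_dom c" "closedin M K" "p \<notin> K" "\<And>q. q \<in> topspace M - K \<Longrightarrow> B q = 0"
  shows "wedge_density B c p = 0"
proof -
  have "chart_deriv c B p u = 0" for u
    by (rule chart_deriv_eq_0[OF assms(1-4)]) (rule assms(5))
  then show ?thesis by (simp add: wedge_density_def wedge_form_def)
qed

lemma chart_inv_notin_image:
  assumes "x \<in> chart_range c - K" "K \<subseteq> chart_range c"
  shows "chart_inv c x \<notin> chart_inv c ` K"
proof
  assume "chart_inv c x \<in> chart_inv c ` K"
  then obtain y where y: "y \<in> K" "chart_inv c x = chart_inv c y" by blast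
  then have "x = y"
    using chart_chart_inv[of x c] chart_chart_inv[of y c] assms by (metis DiffD1 subsetD)
  then show False using assms(1) y(1) by blast
qed

text \<open>On the ball, which is connected, the sign of the area form is constant; so up to that constant the
  density is a compactly supported exact form.\<close>

lemma integral_wedge_density_eq_0:
  assumes "C1_map A B" "c \<in> A" "cball a r \<subseteq> chart_range c"
    and zero: "\<And>p. p \<in> topspace M - chart_inv c ` cball a r \<Longrightarrow> B p = 0"
  shows "integral (chart_range c) (\<lambda>x. wedge_density B c (chart_inv c x)) = 0"
proof -
  let ?J = "\<lambda>x. sgn (area_form c (chart_inv c x))"
  have nz: "area_form c (chart_inv c x) \<noteq> 0" if "x \<in> chart_range c" for x
    by (rule area_form_nonzero[OF assms(2) chart_inv_in_dom[OF that]])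
  have "continuous_on (cball a r) ?J"
    by (intro continuous_on_sgn continuous_on_subset[OF area_form_continuous_on[OF assms(2)] assms(3)] ballI nz)
      (use assms(3) in blast)
  moreover have "finite (?J ` cball a r)"
    by (rule finite_subset[of _ "{-1, 0, 1}"]) (auto simp: sgn_real_def)
  ultimately have "?J constant_on cball a r"
    using continuous_finite_range_constant[OF convex_connected[OF convex_cball]] by blast
  then obtain s where s: "\<And>x. x \<in> cball a r \<Longrightarrow> ?J x = s" unfolding constant_on_def by blast
  have "wedge_density B c (chart_inv c x) = s * wedge_form B c (chart_inv c x)"
    if x: "x \<in> chart_range c" for x
  proof (cases "x \<in> cball a r")
    case True
    then show ?thesis using s by (simp add: wedge_density_def)
  next
    case False
    then have out: "chart_inv c x \<notin> chart_inv c ` cball a r"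
      using chart_inv_notin_image[OF _ assms(3)] x by blast
    have "wedge_density B c (chart_inv c x) = 0"
      by (rule wedge_density_eq_0[OF assms(2) chart_inv_in_dom[OF x]
          closedin_chart_inv_cball[OF assms(2,3)] out]) (rule zero)
    then show ?thesis using nz[OF x] by (simp add: wedge_density_def sgn_zero_iff)
  qed
  then have "integral (chart_range c) (\<lambda>x. wedge_density B c (chart_inv c x)) =
      integral (chart_range c) (\<lambda>x. s * wedge_form B c (chart_inv c x))"
    by (rule integral_cong)
  also have "\<dots> = s * integral (chart_range c) (\<lambda>x. wedge_form B c (chart_inv c x))"
    by simp
  also have "integral (chart_range c) (\<lambda>x. wedge_form B c (chart_inv c x)) =
      integral (chart_range c) (\<lambda>x. frechet_derivative (in_chart c B) (at x) (axis 1 1) \<bullet>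
        frechet_derivative (in_chart c \<psi>) (at x) (axis 2 1) -
        frechet_derivative (in_chart c B) (at x) (axis 2 1) \<bullet>
        frechet_derivative (in_chart c \<psi>) (at x) (axis 1 1))"
    by (rule integral_cong) (simp add: wedge_form_def chart_deriv_def chart_chart_inv)
  also have "\<dots> = 0"
  proof (rule integral_wedge_compact_support_eq_0[OF open_chart_range[OF assms(2)] compact_cball assms(3)
        C1_map_imp_C1_on[OF assms(1,2)] _ C2_on_immersion[OF assms(2)]])
    fix x assume x: "x \<in> chart_range c - cball a r"
    then have "chart_inv c x \<in> topspace M"
      using chart_inv_in_dom[of x c] chart_dom_subset[OF assms(2)] by blast
    then show "in_chart c B x = 0"
      using zero[of "chart_inv c x"] chart_inv_notin_image[OF x assms(3)] by (simp add: in_chart_eq)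
  qed
  finally show ?thesis by simp
qed

text \<open>Both integrals extend over the overlap of the two charts only, where the change of variables formula
  applies to the transition map.\<close>

lemma wedge_density_integral_change_of_charts:
  assumes B: "C1_map A B" and c: "c \<in> A" "cball a r \<subseteq> chart_range c"
    and B0: "\<And>p. p \<in> topspace M - chart_inv c ` cball a r \<Longrightarrow> B p = 0"
    and d: "d \<in> A" "cball a' r' \<subseteq> chart_range d"
    and \<rho>: "C1_map A \<rho>" "\<And>p. p \<notin> chart_inv d ` cball a' r' \<Longrightarrow> \<rho> p = 0"
  shows "integral (chart_range d) (\<lambda>x. \<rho> (chart_inv d x) * wedge_density B d (chart_inv d x)) =
    integral (chart_range c) (\<lambda>x. \<rho> (chart_inv c x) * wedge_density B c (chart_inv c x))"
proof -
  let ?f = "\<lambda>c x. \<rho> (chart_inv c x) * wedge_density B c (chart_inv c x)"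
  define \<tau> where "\<tau> = in_chart c (chart_map d)"
  define S where "S = chart_map c ` (chart_dom c \<inter> chart_dom d)"
  have \<tau>: "\<tau> (chart_map c p) = chart_map d p" if "p \<in> chart_dom c" for p
    using that c(1) by (simp add: \<tau>_def)
  have \<tau>S: "\<tau> ` S = chart_map d ` (chart_dom d \<inter> chart_dom c)"
    unfolding S_def image_image by (rule image_cong) (auto simp: \<tau>)
  have open_S: "open S" unfolding S_def by (rule open_overlap[OF c(1) d(1)])
  have open_\<tau>S: "open (\<tau> ` S)" unfolding \<tau>S by (rule open_overlap[OF d(1) c(1)])
  have cont: "continuous_on (chart_range d) (?f d)"
    using C1_map_continuous_on[OF \<rho>(1) d(1)] wedge_density_continuous_on[OF B d(1)]
    unfolding in_chart_eq by (rule continuous_on_mult)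
  have "?f d absolutely_integrable_on chart_range d"
    by (rule absolutely_integrable_support_in_open[OF open_chart_range[OF d(1)] compact_cball d(2) cont])
      (use \<rho>(2) chart_inv_notin_image[OF _ d(2)] in simp)
  then have int: "?f d absolutely_integrable_on \<tau> ` S"
    by (rule set_integrable_subset) (use open_\<tau>S in \<open>auto simp: \<tau>S\<close>)
  have "integral S (\<lambda>x. \<bar>det (matrix (chart_deriv c (chart_map d) (chart_inv c x)))\<bar> * ?f d (\<tau> x)) =
      integral (\<tau> ` S) (?f d)"
  proof (rule integral_change_of_variables_real_valued[OF _ _ _ int])
    show "S \<in> sets lebesgue" using open_S by auto
    show "(\<tau> has_derivative chart_deriv c (chart_map d) (chart_inv c x)) (at x within S)" if x: "x \<in> S" for x
    proof -
      obtain p where p: "p \<in> chart_dom c" "p \<in> chart_dom d" "x = chart_map c p"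
        using x unfolding S_def by blast
      then show ?thesis
        using transition_has_derivative[OF c(1) d(1) p(1,2)] c(1)
        by (simp add: \<tau>_def has_derivative_at_withinI)
    qed
    show "inj_on \<tau> S"
    proof (rule inj_onI)
      fix x y assume "x \<in> S" "y \<in> S" and eq: "\<tau> x = \<tau> y"
      then obtain p q where pq: "p \<in> chart_dom c" "p \<in> chart_dom d" "x = chart_map c p"
        "q \<in> chart_dom c" "q \<in> chart_dom d" "y = chart_map c q"
        unfolding S_def by blast
      then have "chart_map d p = chart_map d q" using eq \<tau> by simp
      then have "p = q" using inj_on_chart[OF d(1)] pq by (meson inj_onD)
      then show "x = y" using pq by simp
    qed
  qed
  also have "integral S (\<lambda>x. \<bar>det (matrix (chart_deriv c (chart_map d) (chart_inv c x)))\<bar> * ?f d (\<tau> x)) =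
      integral S (?f c)"
  proof (rule integral_cong)
    fix x assume "x \<in> S"
    then obtain p where p: "p \<in> chart_dom c" "p \<in> chart_dom d" "x = chart_map c p"
      unfolding S_def by blast
    then show "\<bar>det (matrix (chart_deriv c (chart_map d) (chart_inv c x)))\<bar> * ?f d (\<tau> x) = ?f c x"
      using c(1) d(1) wedge_density_transition[OF B c(1) d(1) p(1,2)] by (simp add: \<tau>)
  qed
  also have "integral S (?f c) = integral (chart_range c) (?f c)"
  proof (rule integral_eq_on_support[symmetric])
    show "S \<subseteq> chart_range c" by (auto simp: S_def)
    fix x assume x: "x \<in> chart_range c - S"
    then obtain p where p: "p \<in> chart_dom c" "x = chart_map c p" by blast
    have "p \<notin> chart_dom d" using x p unfolding S_def by blast
    then have "p \<notin> chart_inv d ` cball a' r'"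
      using d(2) chart_inv_in_dom[of _ d] by blast
    then show "?f c x = 0" using \<rho>(2) p c(1) by simp
  qed
  also have "integral (\<tau> ` S) (?f d) = integral (chart_range d) (?f d)"
  proof (rule integral_eq_on_support[symmetric])
    show "\<tau> ` S \<subseteq> chart_range d" by (auto simp: \<tau>S)
    fix x assume x: "x \<in> chart_range d - \<tau> ` S"
    then obtain p where p: "p \<in> chart_dom d" "x = chart_map d p" by blast
    have "p \<notin> chart_dom c" using x p unfolding \<tau>S by blast
    then have out: "p \<notin> chart_inv c ` cball a r"
      using c(2) chart_inv_in_dom[of _ c] by blast
    have "wedge_density B d p = 0"
      by (rule wedge_density_eq_0[OF d(1) p(1) closedin_chart_inv_cball[OF c] out]) (rule B0)
    then show "?f d x = 0" using p d(1) by simp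
  qed
  finally show ?thesis by simp
qed

text \<open>Stokes' theorem on a closed surface, in the form in which it is needed: the integral of
  \<open>\<langle>dB \<and> d\<psi>\<rangle>\<close> vanishes, so this form cannot have a sign without being zero.  With a partition of
  unity \<open>\<rho>\<close> the integral is the sum over i and j of the integral of
  \<open>\<rho>\<^sub>j \<langle>d(\<rho>\<^sub>i B) \<and> d\<psi>\<rangle>\<close>, which may be evaluated in chart i instead of chart j; there the sum
  over j is the integral of a compactly supported exact form.\<close>

theorem wedge_density_eq_0_if_nonneg:
  assumes "compact_space M" "C1_map A B"
    and nonneg: "\<And>c p. c \<in> A \<Longrightarrow> p \<in> chart_dom c \<Longrightarrow> wedge_density B c p \<ge> 0"
    and cp: "c \<in> A" "p \<in> chart_dom c"
  shows "wedge_density B c p = 0"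
proof -
  obtain I :: "('a chart \<times> (real^2) \<times> real) set" and C a r \<rho> where
    I: "finite I" "\<And>i. i \<in> I \<Longrightarrow> C i \<in> A" "\<And>i. i \<in> I \<Longrightarrow> cball (a i) (r i) \<subseteq> chart_range (C i)"
    and C1\<rho>: "\<And>i. i \<in> I \<Longrightarrow> C1_map A (\<rho> i)" and \<rho>pos: "\<And>i p. i \<in> I \<Longrightarrow> \<rho> i p \<ge> (0::real)"
    and \<rho>0: "\<And>i p. i \<in> I \<Longrightarrow> p \<notin> chart_inv (C i) ` cball (a i) (r i) \<Longrightarrow> \<rho> i p = 0"
    and \<rho>1: "\<And>p. p \<in> topspace M \<Longrightarrow> (\<Sum>i\<in>I. \<rho> i p) = 1"
    by (rule finite_partition_of_unity[OF assms(1)]) blast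
  let ?V = "\<lambda>i. chart_range (C i)" and ?\<phi> = "\<lambda>i. chart_inv (C i)"
  have V: "open (?V i)" if "i \<in> I" for i using open_chart_range I(2) that by blast
  have inM: "?\<phi> i x \<in> topspace M" if "i \<in> I" "x \<in> ?V i" for i x
    using chart_inv_in_dom[OF that(2)] chart_dom_subset[OF I(2)[OF that(1)]] by blast
  define B' where "B' = (\<lambda>i p. \<rho> i p *\<^sub>R B p)"
  have C1B': "C1_map A (B' i)" if "i \<in> I" for i
    unfolding B'_def by (rule C1_map_bounded_bilinear[OF bounded_bilinear_scaleR C1\<rho>[OF that] assms(2)])
  have B'0: "B' i p = 0" if "i \<in> I" "p \<in> topspace M - ?\<phi> i ` cball (a i) (r i)" for i p
    using \<rho>0 that by (simp add: B'_def)
  have split: "wedge_density B c p = (\<Sum>i\<in>I. wedge_density (B' i) c p)" if "c \<in> A" "p \<in> chart_dom c" for c p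
  proof -
    have "chart_deriv c B p = chart_deriv c (\<lambda>p. \<Sum>i\<in>I. B' i p) p"
    proof (rule chart_deriv_cong[OF that openin_topspace])
      show "B q = (\<Sum>i\<in>I. B' i q)" if "q \<in> topspace M" for q
        using \<rho>1[OF that] by (simp add: B'_def scaleR_left.sum[symmetric])
      show "p \<in> topspace M" using chart_dom_subset[OF that(1)] that(2) by blast
      show "C1_map A (\<lambda>p. \<Sum>i\<in>I. B' i p)" by (rule C1_map_sum[OF I(1) C1B'])
    qed
    then have "wedge_form B c p = (\<Sum>i\<in>I. wedge_form (B' i) c p)"
      using chart_deriv_sum[OF that I(1) C1B']
      by (simp add: wedge_form_def inner_sum_left sum_subtractf)
    then show ?thesis by (simp add: wedge_density_def sum_distrib_left)
  qed
  have cont: "continuous_on (?V i) (\<lambda>x. \<rho> j (?\<phi> i x) * wedge_density E (C i) (?\<phi> i x))"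
    if "i \<in> I" "j \<in> I" "C1_map A E" for i j E
    using C1_map_continuous_on[OF C1\<rho>[OF that(2)] I(2)[OF that(1)]]
      wedge_density_continuous_on[OF that(3) I(2)[OF that(1)]]
    unfolding in_chart_eq by (rule continuous_on_mult)
  have out: "?\<phi> i x \<notin> ?\<phi> i ` cball (a i) (r i)" if "i \<in> I" "x \<in> ?V i - cball (a i) (r i)" for i x
    by (rule chart_inv_notin_image[OF that(2) I(3)[OF that(1)]])
  have int1: "(\<lambda>x. \<rho> j (?\<phi> j x) * wedge_density E (C j) (?\<phi> j x)) integrable_on ?V j"
    if "j \<in> I" "C1_map A E" for j E
    by (rule set_lebesgue_integral_eq_integral(1)[OF absolutely_integrable_support_in_open[OF V[OF that(1)]
            compact_cball I(3)[OF that(1)] cont[OF that(1,1,2)]]])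
      (use \<rho>0[OF that(1) out[OF that(1)]] in simp)
  have int2: "(\<lambda>x. \<rho> j (?\<phi> i x) * wedge_density (B' i) (C i) (?\<phi> i x)) integrable_on ?V i"
    if "i \<in> I" "j \<in> I" for i j
  proof (rule set_lebesgue_integral_eq_integral(1)[OF absolutely_integrable_support_in_open[OF V[OF that(1)]
            compact_cball I(3)[OF that(1)] cont[OF that C1B'[OF that(1)]]]])
    fix x assume x: "x \<in> ?V i - cball (a i) (r i)"
    then have "x \<in> ?V i" by blast
    have "wedge_density (B' i) (C i) (?\<phi> i x) = 0"
      by (rule wedge_density_eq_0[OF I(2)[OF that(1)] chart_inv_in_dom[OF \<open>x \<in> ?V i\<close>]
          closedin_chart_inv_cball[OF I(2)[OF that(1)] I(3)[OF that(1)]] out[OF that(1) x]])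
        (rule B'0[OF that(1)])
    then show "\<rho> j (?\<phi> i x) * wedge_density (B' i) (C i) (?\<phi> i x) = 0" by simp
  qed
  let ?X = "\<lambda>j. integral (?V j) (\<lambda>x. \<rho> j (?\<phi> j x) * wedge_density B (C j) (?\<phi> j x))"
  have "(\<Sum>j\<in>I. ?X j) =
      (\<Sum>j\<in>I. \<Sum>i\<in>I. integral (?V j) (\<lambda>x. \<rho> j (?\<phi> j x) * wedge_density (B' i) (C j) (?\<phi> j x)))"
  proof (rule sum.cong[OF refl])
    fix j assume j: "j \<in> I"
    have "?X j = integral (?V j) (\<lambda>x. \<Sum>i\<in>I. \<rho> j (?\<phi> j x) * wedge_density (B' i) (C j) (?\<phi> j x))"
      by (rule integral_cong) (simp only: split[OF I(2)[OF j] chart_inv_in_dom] sum_distrib_left)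
    also have "\<dots> = (\<Sum>i\<in>I. integral (?V j) (\<lambda>x. \<rho> j (?\<phi> j x) * wedge_density (B' i) (C j) (?\<phi> j x)))"
      by (rule integral_sum[OF I(1) int1[OF j C1B']])
    finally show "?X j = \<dots>" .
  qed
  also have "\<dots> = (\<Sum>j\<in>I. \<Sum>i\<in>I. integral (?V i) (\<lambda>x. \<rho> j (?\<phi> i x) * wedge_density (B' i) (C i) (?\<phi> i x)))"
    by (intro sum.cong refl wedge_density_integral_change_of_charts[OF C1B' I(2) I(3) B'0 I(2) I(3) C1\<rho> \<rho>0])
  also have "\<dots> = (\<Sum>i\<in>I. \<Sum>j\<in>I. integral (?V i) (\<lambda>x. \<rho> j (?\<phi> i x) * wedge_density (B' i) (C i) (?\<phi> i x)))"
    by (rule sum.swap)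
  also have "\<dots> = (\<Sum>i\<in>I. 0)"
  proof (rule sum.cong[OF refl])
    fix i assume i: "i \<in> I"
    have "(\<Sum>j\<in>I. integral (?V i) (\<lambda>x. \<rho> j (?\<phi> i x) * wedge_density (B' i) (C i) (?\<phi> i x))) =
        integral (?V i) (\<lambda>x. \<Sum>j\<in>I. \<rho> j (?\<phi> i x) * wedge_density (B' i) (C i) (?\<phi> i x))"
      by (rule integral_sum[OF I(1) int2[OF i], symmetric])
    also have "\<dots> = integral (?V i) (\<lambda>x. wedge_density (B' i) (C i) (?\<phi> i x))"
      by (rule integral_cong) (simp add: sum_distrib_right[symmetric] \<rho>1[OF inM[OF i]])
    also have "\<dots> = 0"
      by (rule integral_wedge_density_eq_0[OF C1B'[OF i] I(2)[OF i] I(3)[OF i] B'0[OF i]])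
    finally show "(\<Sum>j\<in>I. integral (?V i) (\<lambda>x. \<rho> j (?\<phi> i x) * wedge_density (B' i) (C i) (?\<phi> i x))) = 0" .
  qed
  finally have sum0: "(\<Sum>j\<in>I. ?X j) = 0" by simp
  have pos: "\<rho> j (?\<phi> j x) * wedge_density B (C j) (?\<phi> j x) \<ge> 0" if "j \<in> I" "x \<in> ?V j" for j x
    by (intro mult_nonneg_nonneg \<rho>pos nonneg I(2) that chart_inv_in_dom)
  have X0: "?X j = 0" if "j \<in> I" for j
    using sum_nonneg_eq_0_iff[OF I(1), of ?X] sum0 that
      integral_nonneg[OF int1[OF _ assms(2)] pos] by blast
  have "p \<in> topspace M" using cp chart_dom_subset by blast
  then have "(\<Sum>i\<in>I. \<rho> i p) \<noteq> 0" using \<rho>1 by simp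
  then obtain j where j: "j \<in> I" "\<rho> j p \<noteq> 0" by (metis sum.not_neutral_contains_not_neutral)
  then obtain x where x: "x \<in> cball (a j) (r j)" "p = ?\<phi> j x" using \<rho>0[OF j(1), of p] by blast
  have xV: "x \<in> ?V j" using x(1) I(3)[OF j(1)] by blast
  have "\<rho> j (?\<phi> j x) * wedge_density B (C j) (?\<phi> j x) = 0"
    by (rule nonneg_integral_eq_0_imp_eq_0[OF V[OF j(1)] compact_cball I(3)[OF j(1)]
          cont[OF j(1,1) assms(2)] _ pos[OF j(1)] X0[OF j(1)] xV])
      (use \<rho>0[OF j(1) out[OF j(1)]] in simp)
  then have "wedge_density B (C j) p = 0" using j(2) x(2) by simp
  moreover have "p \<in> chart_dom (C j)" using chart_inv_in_dom[OF xV] x(2) by simp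
  ultimately show ?thesis
    using wedge_density_transition[OF assms(2) cp(1) I(2)[OF j(1)] cp(2)] by simp
qed

end

section \<open>The flux formula and the Gauss map of a closed surface\<close>

context immersed_surface
begin

lemma bounded_linear_cross3: "bounded_linear (cross3 v)"
  using bilinear_cross bilinear_conv_bounded_bilinear bounded_bilinear.bounded_linear_right by blast

text \<open>The potential \<open>B = - v \<times> N - \<lambda> v \<times> \<psi>\<close> produces a multiple of the area form: the derivative of
  the first term contributes the trace of the shape operator, that of the second a constant.\<close>

lemma wedge_form_flux_potential:
  fixes v :: "real^3" and lam :: real
  defines "B \<equiv> \<lambda>p. cross3 (- v) (N p) + cross3 (- lam *\<^sub>R v) (\<psi> p)"
  shows "C1_map A B"
    and "c \<in> A \<Longrightarrow> p \<in> chart_dom c \<Longrightarrow>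
      wedge_form B c p = 2 * (mean_curvature A \<psi> N p - lam) * (N p \<bullet> v) * area_form c p"
proof -
  show "C1_map A B"
    unfolding B_def
    by (intro C1_map_add C1_map_bounded_linear[OF bounded_linear_cross3] C1_map_normal C1_map_immersion)
next
  assume c: "c \<in> A" "p \<in> chart_dom c"
  let ?P = "chart_deriv c \<psi> p" let ?Q = "chart_deriv c N p"
  let ?e = "axis 1 1 :: real^2" let ?e' = "axis 2 1 :: real^2"
  let ?W = "cross3 (?P ?e) (?P ?e')"
  have "(in_chart c B has_derivative (\<lambda>u. cross3 (- v) (?Q u) + cross3 (- lam *\<^sub>R v) (?P u)))
      (at (chart_map c p))"
    unfolding B_def in_chart_def o_def
    by (intro has_derivative_add bounded_linear.has_derivative[OF bounded_linear_cross3])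
      (use chart_deriv_works[OF C1_map_normal c] chart_deriv_works[OF C1_map_immersion c]
        in \<open>simp_all add: in_chart_def o_def\<close>)
  then have D: "chart_deriv c B p u = cross3 (- v) (?Q u) + cross3 (- lam *\<^sub>R v) (?P u)" for u
    by (simp add: chart_deriv_eqI)
  have triple: "cross3 x y \<bullet> z = x \<bullet> cross3 y z" for x y z
    using cross_triple[of x y z] by (simp add: inner_commute)
  have "wedge_form B c p = - (v \<bullet> (cross3 (?Q ?e) (?P ?e') - cross3 (?Q ?e') (?P ?e)))
      - lam * (v \<bullet> ?W - v \<bullet> cross3 (?P ?e') (?P ?e))"
    unfolding wedge_form_def D
    by (simp add: inner_add_left inner_diff_right triple cross_mult_left algebra_simps)
  also have "cross3 (?P ?e') (?P ?e) = - ?W" by (rule cross_skew)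
  also have "- (v \<bullet> (cross3 (?Q ?e) (?P ?e') - cross3 (?Q ?e') (?P ?e))) - lam * (v \<bullet> ?W - v \<bullet> (- ?W)) =
      2 * (mean_curvature A \<psi> N p - lam) * (v \<bullet> ?W)"
    unfolding wedge_eq_mean_curvature[OF c] by (simp add: inner_add_right algebra_simps)
  also have "\<dots> = 2 * (mean_curvature A \<psi> N p - lam) * (N p \<bullet> v) * area_form c p"
    unfolding cross3_tangent_eq_area_form[OF c] by (simp add: inner_commute)
  finally show "wedge_form B c p = 2 * (mean_curvature A \<psi> N p - lam) * (N p \<bullet> v) * area_form c p" .
qed

text \<open>Applying Stokes' theorem to this potential: the integral of \<open>(H - \<lambda>) \<langle>N, v\<rangle>\<close> over a closed
  surface vanishes.\<close>

lemma flux_integrand_eq_0_if_nonneg: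
  assumes "compact_space M"
    and nonneg: "\<And>p. p \<in> topspace M \<Longrightarrow> (mean_curvature A \<psi> N p - lam) * (N p \<bullet> v) \<ge> 0"
    and p: "p \<in> topspace M"
  shows "(mean_curvature A \<psi> N p - lam) * (N p \<bullet> v) = 0"
proof -
  let ?B = "\<lambda>p. cross3 (- v) (N p) + cross3 (- lam *\<^sub>R v) (\<psi> p)"
  have dens: "wedge_density ?B c p =
      2 * ((mean_curvature A \<psi> N p - lam) * (N p \<bullet> v)) * \<bar>area_form c p\<bar>"
    if "c \<in> A" "p \<in> chart_dom c" for c p
    unfolding wedge_density_def wedge_form_flux_potential(2)[OF that] by (simp add: abs_sgn mult_ac)
  obtain c where c: "c \<in> A" "p \<in> chart_dom c" using p topspace_eq by auto
  have "wedge_density ?B c p = 0"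
  proof (rule wedge_density_eq_0_if_nonneg[OF assms(1) wedge_form_flux_potential(1) _ c])
    fix c p assume c: "c \<in> A" "p \<in> chart_dom c"
    then have "p \<in> topspace M" using chart_dom_subset[OF c(1)] by blast
    from nonneg[OF this] show "wedge_density ?B c p \<ge> 0"
      unfolding dens[OF c] by (intro mult_nonneg_nonneg[of "2 * _"] mult_nonneg_nonneg[of 2]) simp_all
  qed
  then show ?thesis
    using area_form_nonzero[OF c] unfolding dens[OF c] by simp
qed

lemma exists_maximum:
  fixes F :: "'a \<Rightarrow> real"
  assumes "compact_space M" "topspace M \<noteq> {}" "C1_map A F"
  obtains p where "p \<in> topspace M" "\<And>q. q \<in> topspace M \<Longrightarrow> F q \<le> F p"
proof -
  have "continuous_map M euclidean F"
    by (rule continuous_map_from_charts) (rule C1_map_continuous_on[OF assms(3)])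
  then have "compactin euclidean (F ` topspace M)"
    using assms(1) image_compactin unfolding compact_space_def by blast
  then have "compact (F ` topspace M)" by simp
  from compact_attains_sup[OF this] assms(2) that show ?thesis by auto
qed

lemma mean_curvature_at_some_maximum:
  assumes "compact_space M" "topspace M \<noteq> {}"
  obtains p \<kappa> where "p \<in> topspace M" "t *\<^sub>R \<psi> p + w = \<kappa> *\<^sub>R N p"
    "t + \<kappa> * mean_curvature A \<psi> N p \<le> 0"
proof -
  have "C1_map A (\<lambda>p. t / 2 * (\<psi> p \<bullet> \<psi> p) + \<psi> p \<bullet> w)"
  proof (rule C1_map_add)
    have "C1_map A (\<lambda>p. \<psi> p \<bullet> \<psi> p)"
      by (rule C1_map_bounded_bilinear[OF bounded_bilinear_inner C1_map_immersion C1_map_immersion])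
    then show "C1_map A (\<lambda>p. t / 2 * (\<psi> p \<bullet> \<psi> p))"
      by (rule C1_map_bounded_linear[OF bounded_linear_mult_right])
    show "C1_map A (\<lambda>p. \<psi> p \<bullet> w)"
      by (rule C1_map_bounded_linear[OF bounded_linear_inner_left C1_map_immersion])
  qed
  then obtain p where p: "p \<in> topspace M" "\<And>q. q \<in> topspace M \<Longrightarrow>
      t / 2 * (\<psi> q \<bullet> \<psi> q) + \<psi> q \<bullet> w \<le> t / 2 * (\<psi> p \<bullet> \<psi> p) + \<psi> p \<bullet> w"
    by (rule exists_maximum[OF assms]) blast
  obtain \<kappa> where "t *\<^sub>R \<psi> p + w = \<kappa> *\<^sub>R N p" "t + \<kappa> * mean_curvature A \<psi> N p \<le> 0"
    by (rule mean_curvature_at_maximum[OF p])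
  with p(1) that show ?thesis by blast
qed

text \<open>At a point farthest from the origin the surface is curved, so H is not zero.  At a highest point
  in a direction w the normal is \<open>\<plusminus> w\<close>, and the sign of H decides which sign occurs; so every unit
  vector is a normal.\<close>

lemma normal_surj_if_constant_mean_curvature:
  assumes "compact_space M" "topspace M \<noteq> {}"
    and H: "\<And>p. p \<in> topspace M \<Longrightarrow> mean_curvature A \<psi> N p = lam"
    and x: "norm x = 1"
  obtains p where "p \<in> topspace M" "N p = x"
proof -
  obtain p \<kappa> where "p \<in> topspace M" "1 + \<kappa> * mean_curvature A \<psi> N p \<le> 0"
    by (rule mean_curvature_at_some_maximum[OF assms(1,2), of 1 0])
  then have lam: "lam \<noteq> 0" using H by auto
  define s where "s = sgn lam"
  have s: "s * s = 1" "s \<noteq> 0" "\<bar>s\<bar> = 1" using lam by (auto simp: s_def sgn_real_def)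
  obtain p \<kappa> where p: "p \<in> topspace M" "0 *\<^sub>R \<psi> p + (- s) *\<^sub>R x = \<kappa> *\<^sub>R N p"
    "0 + \<kappa> * mean_curvature A \<psi> N p \<le> 0"
    by (rule mean_curvature_at_some_maximum[OF assms(1,2), of 0 "(- s) *\<^sub>R x"])
  have "norm ((- s) *\<^sub>R x) = norm (\<kappa> *\<^sub>R N p)" using p(2) by simp
  then have "\<bar>\<kappa>\<bar> = 1" using x norm_normal[OF p(1)] s by simp
  moreover have "\<kappa> * lam \<le> 0" using p(3) H[OF p(1)] by simp
  ultimately have "\<kappa> = - s"
    using lam by (auto simp: s_def sgn_real_def abs_if mult_le_0_iff split: if_splits)
  then have "s *\<^sub>R x = s *\<^sub>R N p" using p(2) by simp
  then have "N p = x" using s(2) by simp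
  with p(1) that show ?thesis by blast
qed

end

lemma eq_0_on_equator:
  fixes f :: "real^3 \<Rightarrow> real"
  assumes "continuous_on (sphere 0 1) f" "v \<in> sphere 0 1"
    and sign: "\<And>x. x \<in> sphere 0 1 \<Longrightarrow> f x * (x \<bullet> v) \<ge> 0"
    and x: "x \<in> sphere 0 1" "x \<bullet> v = 0"
  shows "f x = 0"
proof -
  \<comment> \<open>Moving x along a great circle towards \<open>\<plusminus> v\<close> gives f one sign on either side of the equator.\<close>
  have half: "s * f x \<ge> 0" if s: "s\<^sup>2 = 1" for s :: real
  proof -
    define \<gamma> where "\<gamma> = (\<lambda>t. cos t *\<^sub>R x + (s * sin t) *\<^sub>R v)"
    have on: "\<gamma> t \<in> sphere 0 1" for t
    proof -
      have "\<gamma> t \<bullet> \<gamma> t = (cos t)\<^sup>2 + s\<^sup>2 * (sin t)\<^sup>2"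
        using x assms(2) by (simp add: \<gamma>_def inner_add_left inner_add_right norm_eq_1 inner_commute
            power2_eq_square algebra_simps)
      then show ?thesis using s by (simp add: norm_eq_1)
    qed
    have "continuous_on UNIV (\<lambda>t. s * f (\<gamma> t))"
      by (intro continuous_intros continuous_on_compose2[OF assms(1), of UNIV \<gamma>])
        (use on in \<open>auto simp: \<gamma>_def intro!: continuous_intros\<close>)
    then have "((\<lambda>t. s * f (\<gamma> t)) \<longlongrightarrow> s * f (\<gamma> 0)) (at 0)"
      by (simp add: continuous_on_eq_continuous_at isCont_def)
    then have lim: "((\<lambda>t. s * f (\<gamma> t)) \<longlongrightarrow> s * f x) (at_right 0)"
      using tendsto_within_subset[of _ _ 0 UNIV "{0<..}"] by (simp add: \<gamma>_def)
    have "\<forall>\<^sub>F t in at_right 0. 0 \<le> s * f (\<gamma> t)"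
      unfolding eventually_at_right_field
    proof (intro exI[of _ 1] conjI allI impI)
      fix t :: real assume t: "0 < t" "t < 1"
      have "sin t > 0" using t pi_gt3 by (intro sin_gt_zero) auto
      moreover have "\<gamma> t \<bullet> v = s * sin t"
        using x(2) assms(2) by (simp add: \<gamma>_def inner_add_left norm_eq_1)
      then have "(s * f (\<gamma> t)) * sin t \<ge> 0" using sign[OF on, of t] by (simp add: mult_ac)
      ultimately show "0 \<le> s * f (\<gamma> t)" by (simp add: zero_le_mult_iff)
    qed simp
    then show ?thesis
      by (rule tendsto_lowerbound[OF lim]) simp
  qed
  from half[of 1] half[of "-1"] show ?thesis by simp
qed

theorem proposition2p5:
  fixes \<H> h0 :: "real^3 \<Rightarrow> real" and lam :: real
  assumes "C1_on_sphere \<H>"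
    and "C1_on_sphere h0"
    and "\<exists>x\<in>sphere 0 1. h0 x \<noteq> 0"
    and "\<forall>x\<in>sphere 0 1. \<H> x = h0 x + lam"
    and "\<exists>v\<in>sphere 0 1. \<forall>x\<in>sphere 0 1. h0 x * (x \<bullet> v) \<ge> 0"
  shows "\<not> (\<exists>(M :: 'a topology) A \<psi> N. closed_H_surface \<H> M A \<psi> N)"
proof
  assume "\<exists>(M :: 'a topology) A \<psi> N. closed_H_surface \<H> M A \<psi> N"
  then obtain M :: "'a topology" and A \<psi> N where M: "closed_H_surface \<H> M A \<psi> N" by blast
  then have surf: "smooth_connected_surface M A" "immersion A \<psi>" "gauss_map M A \<psi> N"
    and H: "\<And>p. p \<in> topspace M \<Longrightarrow> mean_curvature A \<psi> N p = \<H> (N p)"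
    and comp: "compact_space M"
    by (auto simp: closed_H_surface_def H_surface_def oriented_immersed_surface_def)
  interpret immersed_surface M A \<psi> N
    using surf by unfold_locales (auto simp: smooth_connected_surface_def)
  have ne: "topspace M \<noteq> {}" using surf by (simp add: smooth_connected_surface_def)
  have N: "N p \<in> sphere 0 1" if "p \<in> topspace M" for p using norm_normal[OF that] by simp
  obtain v where v: "v \<in> sphere 0 1" "\<And>x. x \<in> sphere 0 1 \<Longrightarrow> h0 x * (x \<bullet> v) \<ge> 0"
    using assms(5) by blast
  have cont: "continuous_on (sphere 0 1) h0"
  proof -
    obtain U g where "sphere 0 1 \<subseteq> U" "Ck_on 1 g U" "\<forall>x\<in>sphere 0 1. g x = h0 x"
      using assms(2) unfolding C1_on_sphere_def by blast
    then show ?thesis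
      by (metis C1_on_imp_continuous_on continuous_on_eq continuous_on_subset)
  qed
  have Hlam: "mean_curvature A \<psi> N p - lam = h0 (N p)" if "p \<in> topspace M" for p
    using H[OF that] assms(4) N[OF that] by simp
  have h0N: "h0 (N p) = 0" if p: "p \<in> topspace M" for p
  proof (cases "N p \<bullet> v = 0")
    case True
    show ?thesis by (rule eq_0_on_equator[OF cont v(1) _ N[OF p] True]) (rule v(2))
  next
    case False
    have "(mean_curvature A \<psi> N p - lam) * (N p \<bullet> v) = 0"
      by (rule flux_integrand_eq_0_if_nonneg[OF comp _ p]) (simp only: Hlam v(2) N)
    with False show ?thesis by (simp add: Hlam[OF p])
  qed
  obtain x where x: "x \<in> sphere 0 1" "h0 x \<noteq> 0" using assms(3) by blast
  obtain p where "p \<in> topspace M" "N p = x"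
  proof (rule normal_surj_if_constant_mean_curvature[OF comp ne])
    show "mean_curvature A \<psi> N p = lam" if "p \<in> topspace M" for p
      using Hlam[OF that] h0N[OF that] by simp
    show "norm x = 1" using x(1) by simp
  qed
  then show False using h0N x(2) by blast
qed

end
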